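(* Let $m,n\ge1$ be integers and $l_1,\dots,l_m$ positive integers. Let $Z_1,\dots,Z_n$ be complex random variables whose joint density with respect to Lebesgue measure on $\mathbb{C}^n$ is $$p(z_1,\dots,z_n)=C\prod_{1\le j<k\le n}|z_j-z_k|^2\prod_{j=1}^nw_m^{(l_1,\dots,l_m)}(|z_j|)$$ for $\max_{1\le j\le n}|z_j|<1$ (and $0$ otherwise), where $C$ is the normalizing constant and $w_m^{(l_1,\dots,l_m)}$ is the weight function defined in the context. Let $\{s_{j,r},\ 1\le j\le n,\ 1\le r\le m\}$ be independent random variables such that $s_{j,r}$ has the Beta density $\frac{1}{B(j,l_r)}y^{j-1}(1-y)^{l_r-1}I(0\le y\le1)$ for each $j$ and $r$. Then $g(|Z_1|^2,\dots,|Z_n|^2)$ and $g\big(\prod_{r=1}^ms_{1,r},\dots,\prod_{r=1}^ms_{n,r}\big)$ have the same distribution for any symmetric function $g(t_1,\dots,t_n)$.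
   Context: The weights are defined recursively: $w_1^{(l)}(s)=\frac{l}{\pi}(1-s^2)^{l-1}I(0\le s<1)$ and, for $m\ge2$, $$w_m^{(l_1,\dots,l_m)}(s)=2\pi\int_0^1w_1^{(l_m)}(u)\,w_{m-1}^{(l_1,\dots,l_{m-1})}\Big(\frac su\Big)\frac{du}{u},\qquad s\in[0,1),$$ with all weights equal to $0$ for $s\ge1$. $B(a,b)=\int_0^1s^{a-1}(1-s)^{b-1}ds$ is the beta function and $I(\cdot)$ is the indicator. (This $p$ is the joint density of the eigenvalues of the product $\mathbf{X}_m\cdots\mathbf{X}_1$, where $\mathbf{X}_j$ is the upper-left $n\times n$ block of an $(n+l_j)\times(n+l_j)$ Haar unitary matrix and these unitary matrices are independent.) Symmetric functions are understood to be measurable. *)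

theory Defs
  imports "HOL-Probability.Probability" "HOL-Combinatorics.Permutations"
begin

definition weight1 :: "nat \<Rightarrow> real \<Rightarrow> real" where
  "weight1 l s = real l / pi * (1 - s\<^sup>2) ^ (l - 1) * indicator {0..<1} s"

text \<open>
  The parameters \<open>l\<^sub>1, \<dots>, l\<^sub>m\<close> are the values \<open>l 1, \<dots>, l m\<close>. For \<open>m \<ge> 2\<close> the integral defining
  the weight diverges at \<open>s = 0\<close>, so the weights take values in \<^typ>\<open>ennreal\<close>; they are finite
  for \<open>s > 0\<close>. The case \<open>m = 0\<close> is a dummy value.
\<close>

fun weight :: "nat \<Rightarrow> (nat \<Rightarrow> nat) \<Rightarrow> real \<Rightarrow> ennreal" where
  "weight 0 l s = 0"
| "weight (Suc 0) l s = ennreal (weight1 (l 1) s)"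
| "weight (Suc (Suc m)) l s =
     (if 0 \<le> s \<and> s < 1
      then ennreal (2 * pi) *
        (\<integral>\<^sup>+u\<in>{0<..<1}. (ennreal (weight1 (l (Suc (Suc m))) u) * weight (Suc m) l (s / u)
           * ennreal (1 / u)) \<partial>lborel)
      else 0)"

definition eigenvalue_density ::
  "real \<Rightarrow> nat \<Rightarrow> nat \<Rightarrow> (nat \<Rightarrow> nat) \<Rightarrow> (nat \<Rightarrow> complex) \<Rightarrow> ennreal" where
  "eigenvalue_density C n m l z =
     (if (MAX j\<in>{1..n}. norm (z j)) < 1
      then ennreal C * ennreal (\<Prod>j\<in>{1..n}. \<Prod>k\<in>{j<..n}. (norm (z j - z k))\<^sup>2)
        * (\<Prod>j\<in>{1..n}. weight m l (norm (z j)))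
      else 0)"

definition beta_pdf :: "nat \<Rightarrow> nat \<Rightarrow> real \<Rightarrow> real" where
  "beta_pdf a b y =
     1 / Beta (real a) (real b) * y ^ (a - 1) * (1 - y) ^ (b - 1) * indicator {0..1} y"

text \<open>
  Vectors \<open>(t\<^sub>1, \<dots>, t\<^sub>n)\<close> are extensional functions on \<open>{1..n}\<close>, i.e. the points of
  a product measure over \<open>{1..n}\<close>.
\<close>

definition symmetric_function :: "nat \<Rightarrow> ((nat \<Rightarrow> real) \<Rightarrow> 'c) \<Rightarrow> bool" where
  "symmetric_function n g \<longleftrightarrow>
     (\<forall>\<sigma>. \<sigma> permutes {1..n} \<longrightarrow> (\<forall>t \<in> {1..n} \<rightarrow>\<^sub>E UNIV. g (\<lambda>j\<in>{1..n}. t (\<sigma> j)) = g t))"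

end

theory Submission
  imports Defs "HOL-Computational_Algebra.Polynomial"
begin

text \<open>
  Expand \<open>\<Prod>\<^sub>j\<^sub><\<^sub>k |z\<^sub>j - z\<^sub>k|\<^sup>2\<close> as the Vandermonde determinant times its conjugate, i.e. as a double sum
  over permutations \<open>\<sigma>, \<tau>\<close>. Against a rotation invariant product measure only the terms \<open>\<sigma> = \<tau>\<close>
  survive, and for a symmetric function of the moduli these \<open>n!\<close> terms agree. Hence the moduli
  behave as if \<open>Z\<^sub>1, \<dots>, Z\<^sub>n\<close> were independent, \<open>Z\<^sub>j\<close> having density proportional to
  \<open>|z|\<^bsup>2(j-1)\<^esup> w\<^sub>m(|z|)\<close>. The recursion for \<open>w\<^sub>m\<close> is a multiplicative convolution, so under this
  density \<open>|Z\<^sub>j|\<^sup>2\<close> is a product of independent beta variables. No constant has to be computed: both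
  sides are probability measures, so it is enough to show that they are proportional.
\<close>

subsection \<open>The Vandermonde determinant\<close>

text \<open>For \<open>m \<ge> 2\<close> the weights are infinite at 0 and live in
  \<open>ennreal\<close>, whereas the double sum over permutations has signed complex terms and
  calls for Bochner integrals. The weights are therefore absorbed into a reference measure: the
  probability measure \<open>\<nu> 1\<close> on the plane whose density is proportional to
  \<open>weight m l (norm z)\<close>. What remains of the integrand is bounded and supported in the
  open unit polydisc, where every monomial has modulus at most 1, so each term is integrable without
  any estimate of the weights. That the weight has finite mass is itself the case
  \<open>j = 1\<close> of the moment identity that produces the products of beta variables. Rotation
  invariance of planar Lebesgue measure is obtained from one-variable substitutions that divide by
  \<open>Re c\<close>; hence only rotations with \<open>Re c \<noteq> 0\<close> occur, and these are
  enough to cancel the cross terms.\<close>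

lemma alternating_sum_eq_0:
  fixes z :: "nat \<Rightarrow> 'a::{idom, ring_char_0}"
  assumes S: "finite S" and ab: "a \<in> S" "b \<in> S" "a \<noteq> b" and z: "z a = z b"
  shows "(\<Sum>\<sigma> | \<sigma> permutes S. of_int (sign \<sigma>) * (\<Prod>j\<in>S. z j ^ e (\<sigma> j))) = 0"
proof -
  let ?t = "Transposition.transpose a b"
  let ?f = "\<lambda>\<sigma>. of_int (sign \<sigma>) * (\<Prod>j\<in>S. z j ^ e (\<sigma> j))"
  have t: "?t permutes S" using ab by (intro permutes_swap_id) auto
  have zt: "z (?t j) = z j" for j using z by (auto simp: Transposition.transpose_def)
  \<comment> \<open>Swapping \<open>a\<close> and \<open>b\<close> flips the sign and, as
    \<open>z a = z b\<close>, keeps the product. So the sum equals its own negative, and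
    characteristic 0 makes it vanish.\<close>
  have eq: "?f (\<sigma> \<circ> ?t) = - ?f \<sigma>" if s: "\<sigma> permutes S" for \<sigma>
  proof -
    have "sign (\<sigma> \<circ> ?t) = - sign \<sigma>"
      using ab s S by (subst sign_compose) (auto simp: permutation_swap_id sign_swap_id intro: permutes_imp_permutation)
    moreover have "(\<Prod>j\<in>S. z j ^ e ((\<sigma> \<circ> ?t) j)) = (\<Prod>j\<in>S. z (?t j) ^ e (\<sigma> (?t j)))"
      by (simp add: zt)
    moreover have "\<dots> = (\<Prod>j\<in>S. z j ^ e (\<sigma> j))"
      using prod.permute[OF t, of "\<lambda>j. z j ^ e (\<sigma> j)"] by (simp add: o_def)
    ultimately show ?thesis by simp
  qed
  have "(\<Sum>\<sigma> | \<sigma> permutes S. ?f \<sigma>) = (\<Sum>\<sigma> | \<sigma> permutes S. ?f (\<sigma> \<circ> ?t))"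
    by (rule sum_permutations_compose_right[OF t])
  also have "\<dots> = - (\<Sum>\<sigma> | \<sigma> permutes S. ?f \<sigma>)"
    unfolding sum_negf[symmetric] using eq by (intro sum.cong) auto
  finally show ?thesis by simp
qed

text \<open>Induction on the number of variables. Both sides are polynomials in the last variable of
  degree at most \<open>n\<close>, they vanish at the first \<open>n\<close> variables, and their
  coefficient of degree \<open>n\<close> is the Vandermonde product of those.\<close>

lemma vandermonde_sum:
  fixes z :: "nat \<Rightarrow> 'a::{idom, ring_char_0}"
  shows "(\<Sum>\<sigma> | \<sigma> permutes {1..n}. of_int (sign \<sigma>) * (\<Prod>j\<in>{1..n}. z j ^ (\<sigma> j - 1)))
       = (\<Prod>j\<in>{1..n}. \<Prod>k\<in>{j<..n}. z k - z j)"
proof (induction n arbitrary: z)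
  case 0
  show ?case by simp
next
  case (Suc n)
  let ?S = "{1..Suc n}"
  let ?c = "\<lambda>\<sigma>. of_int (sign \<sigma>) * (\<Prod>j\<in>{1..n}. z j ^ (\<sigma> j - 1))"
  \<comment> \<open>The alternating sum with \<open>z (Suc n)\<close> replaced by an
    indeterminate.\<close>
  define p where "p = (\<Sum>\<sigma> | \<sigma> permutes ?S. Polynomial.monom (?c \<sigma>) (\<sigma> (Suc n) - 1))"
  have S: "?S = insert (Suc n) {1..n}" by auto
  have poly_p: "poly p x = (\<Sum>\<sigma> | \<sigma> permutes ?S. of_int (sign \<sigma>) * (\<Prod>j\<in>?S. (z(Suc n := x)) j ^ (\<sigma> j - 1)))" for x
  proof -
    have "(\<Prod>j\<in>{1..n}. (if j = Suc n then x else z j) ^ (\<sigma> j - 1)) = (\<Prod>j\<in>{1..n}. z j ^ (\<sigma> j - 1))" for \<sigma>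
      by (intro prod.cong) auto
    then show ?thesis unfolding p_def poly_sum S by (simp add: poly_monom mult_ac)
  qed
  have deg: "degree p \<le> n"
    unfolding p_def
  proof (intro degree_sum_le)
    show "finite {\<sigma>. \<sigma> permutes ?S}" by (simp add: finite_permutations)
    fix \<sigma> assume "\<sigma> \<in> {\<sigma>. \<sigma> permutes ?S}"
    then have "\<sigma> (Suc n) \<in> ?S" using permutes_in_image[of \<sigma> ?S "Suc n"] by auto
    then have "\<sigma> (Suc n) - 1 \<le> n" by auto
    then show "degree (Polynomial.monom (?c \<sigma>) (\<sigma> (Suc n) - 1)) \<le> n"
      using degree_monom_le[of "?c \<sigma>" "\<sigma> (Suc n) - 1"] by linarith
  qed
  have sub: "{\<sigma>. \<sigma> permutes {1..n}} \<subseteq> {\<sigma>. \<sigma> permutes ?S}"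
    by (auto intro: permutes_subset)
  have coeff: "coeff p n = (\<Prod>j\<in>{1..n}. \<Prod>k\<in>{j<..n}. z k - z j)"
  proof -
    have "coeff p n = (\<Sum>\<sigma> | \<sigma> permutes ?S. if \<sigma> (Suc n) - 1 = n then ?c \<sigma> else 0)"
      unfolding p_def coeff_sum
      by (intro sum.cong refl) simp
    \<comment> \<open>The exponent \<open>n\<close> is reached only if \<open>\<sigma>\<close> fixes
      \<open>Suc n\<close>, and these are exactly the permutations of \<open>{1..n}\<close>.\<close>
    also have "\<dots> = (\<Sum>\<sigma> | \<sigma> permutes {1..n}. ?c \<sigma>)"
    proof (rule sum.mono_neutral_cong_right)
      show "finite {\<sigma>. \<sigma> permutes ?S}" by (simp add: finite_permutations)
      show "\<forall>\<sigma>\<in>{\<sigma>. \<sigma> permutes ?S} - {\<sigma>. \<sigma> permutes {1..n}}. (if \<sigma> (Suc n) - 1 = n then ?c \<sigma> else 0) = 0"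
      proof
        fix \<sigma> assume "\<sigma> \<in> {\<sigma>. \<sigma> permutes ?S} - {\<sigma>. \<sigma> permutes {1..n}}"
        then have s: "\<sigma> permutes ?S" "\<not> \<sigma> permutes {1..n}" by auto
        have "\<sigma> (Suc n) \<in> ?S" using permutes_in_image[OF s(1), of "Suc n"] by auto
        moreover have "\<sigma> (Suc n) \<noteq> Suc n"
        proof
          assume "\<sigma> (Suc n) = Suc n"
          then have "\<sigma> permutes {1..n}"
            using le_Suc_eq by (intro permutes_superset[OF s(1)]) auto
          then show False using s(2) by simp
        qed
        ultimately show "(if \<sigma> (Suc n) - 1 = n then ?c \<sigma> else 0) = 0" by auto
      qed
      fix \<sigma> assume "\<sigma> \<in> {\<sigma>. \<sigma> permutes {1..n}}"
      then have "\<sigma> (Suc n) = Suc n" by (auto simp: permutes_def)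
      then show "(if \<sigma> (Suc n) - 1 = n then ?c \<sigma> else 0) = ?c \<sigma>" by simp
    qed (fact sub)
    finally show ?thesis using Suc.IH by simp
  qed
  have goal_rhs: "(\<Prod>j\<in>?S. \<Prod>k\<in>{j<..Suc n}. z k - z j)
      = (\<Prod>j\<in>{1..n}. \<Prod>k\<in>{j<..n}. z k - z j) * (\<Prod>j\<in>{1..n}. z (Suc n) - z j)"
  proof -
    have "(\<Prod>j\<in>?S. \<Prod>k\<in>{j<..Suc n}. z k - z j) = (\<Prod>j\<in>{1..n}. \<Prod>k\<in>{j<..Suc n}. z k - z j)"
      unfolding S by simp
    also have "\<dots> = (\<Prod>j\<in>{1..n}. (\<Prod>k\<in>{j<..n}. z k - z j) * (z (Suc n) - z j))"
    proof (intro prod.cong refl)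
      fix j assume "j \<in> {1..n}"
      then have "{j<..Suc n} = insert (Suc n) {j<..n}" by auto
      then show "(\<Prod>k\<in>{j<..Suc n}. z k - z j) = (\<Prod>k\<in>{j<..n}. z k - z j) * (z (Suc n) - z j)"
        by (simp add: mult.commute)
    qed
    finally show ?thesis by (simp add: prod.distrib)
  qed
  have root: "poly p (z i) = 0" if i: "i \<in> {1..n}" for i
    unfolding poly_p using i
    by (intro alternating_sum_eq_0[where a = i and b = "Suc n" and e = "\<lambda>k. k - 1"]) auto
  have lhs: "(\<Sum>\<sigma> | \<sigma> permutes ?S. of_int (sign \<sigma>) * (\<Prod>j\<in>?S. z j ^ (\<sigma> j - 1))) = poly p (z (Suc n))"
    unfolding poly_p by simp
  \<comment> \<open>The root count needs the first \<open>n\<close> values to be distinct; if two of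
    them coincide, both sides vanish.\<close>
  show ?case
  proof (cases "inj_on z {1..n}")
    case False
    then obtain a b where ab: "a \<in> {1..n}" "b \<in> {1..n}" "a \<noteq> b" "z a = z b"
      by (auto simp: inj_on_def)
    have "(\<Prod>j\<in>{1..n}. \<Prod>k\<in>{j<..n}. z k - z j) = 0"
    proof -
      have "\<exists>j\<in>{1..n}. \<exists>k\<in>{j<..n}. z k - z j = 0"
      proof (cases "a < b")
        case True
        then show ?thesis using ab by (intro bexI[of _ a] bexI[of _ b]) auto
      next
        case False
        then show ?thesis using ab by (intro bexI[of _ b] bexI[of _ a]) auto
      qed
      then show ?thesis by (auto simp: prod_zero_iff)
    qed
    moreover have "(\<Sum>\<sigma> | \<sigma> permutes ?S. of_int (sign \<sigma>) * (\<Prod>j\<in>?S. z j ^ (\<sigma> j - 1))) = 0"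
      using ab by (intro alternating_sum_eq_0[where a = a and b = b and e = "\<lambda>k. k - 1"]) auto
    ultimately show ?thesis using goal_rhs by simp
  next
    case True
    \<comment> \<open>The claimed factorisation. It shares with \<open>p\<close> the coefficient of
      degree \<open>n\<close> and the \<open>n\<close> distinct roots, so a nonzero
      \<open>p - q\<close> would have more roots than its degree allows.\<close>
    define q where "q = smult (coeff p n) (\<Prod>i\<in>{1..n}. [:- z i, 1:])"
    have dprod: "degree (\<Prod>i\<in>{1..n}. [:- z i, 1:]) = n"
      by (subst degree_prod_eq_sum_degree) auto
    have lc: "coeff (\<Prod>i\<in>{1..n}. [:- z i, 1:]) n = 1"
    proof -
      have "lead_coeff (\<Prod>i\<in>{1..n}. [:- z i, 1:]) = 1"
        by (simp add: lead_coeff_prod)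
      then show ?thesis unfolding dprod .
    qed
    have "p - q = 0"
    proof (rule ccontr)
      assume ne: "p - q \<noteq> 0"
      have "degree q \<le> n" unfolding q_def using degree_smult_le dprod by metis
      then have "degree (p - q) \<le> n" using deg by (intro degree_diff_le)
      moreover have "coeff (p - q) n = 0" using lc by (simp add: q_def)
      \<comment> \<open>No degree lies below \<open>n = 0\<close>; that case is excluded next,
        because \<open>p - q\<close> would be a constant whose only coefficient is 0.\<close>
      ultimately have d: "degree (p - q) < n \<or> n = 0"
        using ne by (metis eq_zero_or_degree_less leading_coeff_0_iff le_neq_implies_less)
      have n0: "n \<noteq> 0"
        using ne \<open>degree (p - q) \<le> n\<close> \<open>coeff (p - q) n = 0\<close> by (metis leading_coeff_0_iff le_zero_eq)
      have r: "z ` {1..n} \<subseteq> {x. poly (p - q) x = 0}"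
      proof safe
        fix i assume i: "i \<in> {1..n}"
        then have "(\<Prod>k\<in>{1..n}. z i - z k) = 0" by (intro prod_zero) auto
        then show "poly (p - q) (z i) = 0" using root[OF i] by (simp add: q_def poly_prod)
      qed
      have "n = card (z ` {1..n})" using True by (simp add: card_image)
      also have "\<dots> \<le> card {x. poly (p - q) x = 0}" using r ne by (intro card_mono poly_roots_finite)
      also have "\<dots> \<le> degree (p - q)" using ne by (rule card_poly_roots_bound)
      finally show False using d n0 by simp
    qed
    then have "poly p (z (Suc n)) = poly q (z (Suc n))" by simp
    also have "\<dots> = coeff p n * (\<Prod>i\<in>{1..n}. z (Suc n) - z i)"
      unfolding q_def by (simp add: poly_prod)
    finally have "poly p (z (Suc n)) = coeff p n * (\<Prod>i\<in>{1..n}. z (Suc n) - z i)" .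
    then show ?thesis unfolding lhs goal_rhs coeff .
  qed
qed

subsection \<open>Lebesgue measure on the complex plane\<close>

lemma Complex_measurable [measurable]:
  "(\<lambda>p. Complex (fst p) (snd p)) \<in> borel_measurable (borel \<Otimes>\<^sub>M borel)"
  unfolding borel_prod
  by (intro borel_measurable_continuous_onI continuous_intros)

text \<open>Volumes of boxes determine Lebesgue measure, and a complex box is a product of two
  intervals. This provides the Cartesian coordinates on which Fubini acts.\<close>

lemma lborel_complex_eq_distr:
  "(lborel :: complex measure) = distr (lborel \<Otimes>\<^sub>M lborel) borel (\<lambda>(x, y). Complex x y)"
proof (rule lborel_eqI)
  fix l u :: complex assume le: "\<And>b. b \<in> Basis \<Longrightarrow> l \<bullet> b \<le> u \<bullet> b"
  have "Re l \<le> Re u" "Im l \<le> Im u" using le[of 1] le[of \<i>] by (simp_all add: Basis_complex_def)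
  moreover have "(\<lambda>(x, y). Complex x y) -` box l u = {Re l<..<Re u} \<times> {Im l<..<Im u}"
    by (auto simp: box_def Basis_complex_def)
  ultimately show "emeasure (distr (lborel \<Otimes>\<^sub>M lborel) borel (\<lambda>(x, y). Complex x y)) (box l u) = (\<Prod>b\<in>Basis. (u - l) \<bullet> b)"
    using Complex_measurable
    by (subst emeasure_distr)
       (auto simp: space_pair_measure lborel.emeasure_pair_measure_Times Basis_complex_def case_prod_beta ennreal_mult)
qed simp

lemma nn_integral_lborel_complex:
  fixes f :: "complex \<Rightarrow> ennreal"
  assumes [measurable]: "f \<in> borel_measurable borel"
  shows "(\<integral>\<^sup>+z. f z \<partial>lborel) = (\<integral>\<^sup>+x. \<integral>\<^sup>+y. f (Complex x y) \<partial>lborel \<partial>lborel)"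
proof -
  show ?thesis
    by (subst lborel_complex_eq_distr)
       (simp add: nn_integral_distr split_beta' lborel.nn_integral_fst[symmetric])
qed

text \<open>The rotation is undone by two affine substitutions, one in \<open>x\<close> for fixed
  \<open>y\<close> and one in \<open>y\<close> for fixed \<open>x\<close>, whose Jacobian factors
  cancel. Both divide by \<open>a = Re c\<close>, which is where \<open>Re c \<noteq> 0\<close>
  comes from.\<close>

lemma nn_integral_lborel_rotate:
  fixes f :: "complex \<Rightarrow> ennreal"
  assumes [measurable]: "f \<in> borel_measurable borel" and c: "norm c = 1" "Re c \<noteq> 0"
  shows "(\<integral>\<^sup>+z. f (c * z) \<partial>lborel) = (\<integral>\<^sup>+z. f z \<partial>lborel)"
proof -
  define a b where "a = Re c" and "b = Im c"
  have ab: "a\<^sup>2 + b\<^sup>2 = 1" "a \<noteq> 0" using c by (auto simp: a_def b_def cmod_def)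
  have m: "(\<lambda>w. f (Complex (u w) (v w))) \<in> borel_measurable N"
    if "u \<in> borel_measurable N" "v \<in> borel_measurable N" for u v and N :: "'b measure"
  proof -
    have "(\<lambda>w. (u w, v w)) \<in> N \<rightarrow>\<^sub>M borel \<Otimes>\<^sub>M borel" using that by simp
    from measurable_compose[OF measurable_compose[OF this Complex_measurable] assms(1)] show ?thesis by simp
  qed
  let ?F = "\<lambda>x y. f (Complex (a * x - b * y) (b * x + a * y))"
  have "(\<integral>\<^sup>+z. f (c * z) \<partial>lborel) = (\<integral>\<^sup>+x. \<integral>\<^sup>+y. ?F x y \<partial>lborel \<partial>lborel)"
    by (subst nn_integral_lborel_complex) (auto simp: a_def b_def complex_eq_iff intro!: nn_integral_cong arg_cong[of _ _ f])
  also have "\<dots> = (\<integral>\<^sup>+y. \<integral>\<^sup>+x. ?F x y \<partial>lborel \<partial>lborel)"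
    by (intro lborel_pair.Fubini') (auto simp: split_beta' intro!: m)
  also have "\<dots> = (\<integral>\<^sup>+y. ennreal \<bar>1/a\<bar> * (\<integral>\<^sup>+x. f (Complex x (b / a * x + y / a)) \<partial>lborel) \<partial>lborel)"
  proof (intro nn_integral_cong)
    fix y
    have e: "a * (b / a * y + 1 / a * x) - b * y = x" "b * (b / a * y + 1 / a * x) + a * y = b / a * x + y / a" for x
    proof -
      show "a * (b / a * y + 1 / a * x) - b * y = x" using ab by (simp add: field_simps)
      \<comment> \<open>Here \<open>norm c = 1\<close> enters: the terms in \<open>y\<close> combine
        with coefficient \<open>(a\<^sup>2 + b\<^sup>2) / a\<close>.\<close>
      have "b * (b / a * y + 1 / a * x) + a * y = b / a * x + (a\<^sup>2 + b\<^sup>2) * y / a" using ab(2) by (simp add: field_simps power2_eq_square)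
      then show "b * (b / a * y + 1 / a * x) + a * y = b / a * x + y / a" using ab(1) by simp
    qed
    have "(\<integral>\<^sup>+x. ?F x y \<partial>lborel) = ennreal \<bar>1/a\<bar> * (\<integral>\<^sup>+x. ?F (b / a * y + 1 / a * x) y \<partial>lborel)"
      using ab by (intro nn_integral_real_affine m) auto
    then show "(\<integral>\<^sup>+x. ?F x y \<partial>lborel) = ennreal \<bar>1/a\<bar> * (\<integral>\<^sup>+x. f (Complex x (b / a * x + y / a)) \<partial>lborel)"
      unfolding e .
  qed
  also have "\<dots> = ennreal \<bar>1/a\<bar> * (\<integral>\<^sup>+y. \<integral>\<^sup>+x. f (Complex x (b / a * x + y / a)) \<partial>lborel \<partial>lborel)"
    by (intro nn_integral_cmult lborel.borel_measurable_nn_integral) (auto simp: split_beta' intro!: m)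
  also have "\<dots> = ennreal \<bar>1/a\<bar> * (\<integral>\<^sup>+x. \<integral>\<^sup>+y. f (Complex x (b / a * x + y / a)) \<partial>lborel \<partial>lborel)"
    by (intro arg_cong[where f = "\<lambda>x. _ * x"] lborel_pair.Fubini') (auto simp: split_beta' intro!: m)
  also have "\<dots> = (\<integral>\<^sup>+x. ennreal \<bar>1/a\<bar> * (\<integral>\<^sup>+y. f (Complex x (b / a * x + y / a)) \<partial>lborel) \<partial>lborel)"
    by (intro nn_integral_cmult[symmetric] lborel.borel_measurable_nn_integral) (auto simp: split_beta' intro!: m)
  also have "\<dots> = (\<integral>\<^sup>+x. \<integral>\<^sup>+y. f (Complex x y) \<partial>lborel \<partial>lborel)"
  proof (intro nn_integral_cong)
    fix x
    have "(\<integral>\<^sup>+y. f (Complex x y) \<partial>lborel) = ennreal \<bar>1/a\<bar> * (\<integral>\<^sup>+y. f (Complex x (b / a * x + 1 / a * y)) \<partial>lborel)"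
      using ab by (intro nn_integral_real_affine m) auto
    then show "ennreal \<bar>1/a\<bar> * (\<integral>\<^sup>+y. f (Complex x (b / a * x + y / a)) \<partial>lborel) = (\<integral>\<^sup>+y. f (Complex x y) \<partial>lborel)"
      by simp
  qed
  also have "\<dots> = (\<integral>\<^sup>+z. f z \<partial>lborel)"
    by (simp add: nn_integral_lborel_complex)
  finally show ?thesis .
qed

section \<open>Polar coordinates: the modulus and its square under Lebesgue measure\<close>

lemma emeasure_lborel_norm_less:
  "emeasure lborel {z :: complex. norm z < r} = ennreal (pi * (max 0 r)\<^sup>2)"
proof -
  have "{z :: complex. norm z < r} = ball 0 (max 0 r)"
    using norm_ge_zero by (auto simp: less_max_iff_disj not_less[symmetric])
  then show ?thesis
    by (simp add: emeasure_ball unit_ball_vol_2 mult.commute)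
qed

text \<open>Half-lines form an intersection-stable generator. The measures compared by means of it
  have infinite total mass, so the line is exhausted by half-lines with rational end points, which
  have finite mass.\<close>

lemma measure_eqI_Iio:
  fixes M N :: "real measure"
  assumes sets: "sets M = sets borel" "sets N = sets borel"
  assumes fin: "\<And>x. emeasure M {..<x} < \<infinity>"
  assumes "\<And>x. emeasure M {..<x} = emeasure N {..<x}"
  shows "M = N"
proof (rule measure_eqI_generator_eq_countable)
  let ?LT = "\<lambda>a::real. {..<a}" let ?E = "range ?LT"
  show "Int_stable ?E"
    unfolding Int_stable_def
  proof safe
    fix a b :: real
    have "{..<a} \<inter> {..<b} = {..<min a b}" by auto
    then show "{..<a} \<inter> {..<b} \<in> ?E" by simp
  qed
  show "?E \<subseteq> Pow UNIV" "sets M = sigma_sets UNIV ?E" "sets N = sigma_sets UNIV ?E"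
    unfolding sets borel_Iio by auto
  have "\<exists>q\<in>Rats. x < q" for x :: real
    using Rats_dense_in_real[of x "x + 1"] by auto
  then show "(\<Union>i\<in>Rats. ?LT i) = UNIV" by auto
  show "?LT`Rats \<subseteq> ?E" "\<And>a. a \<in> ?LT`Rats \<Longrightarrow> emeasure M a \<noteq> \<infinity>"
    using fin by (auto simp: less_top)
qed (auto intro: assms countable_rat)

text \<open>The area \<open>pi * x\<^sup>2\<close> of a disc has derivative
  \<open>2 * pi * x\<close>, so the radial part of polar coordinates comes out without an angular
  variable.\<close>

lemma distr_lborel_norm:
  "distr lborel borel (norm :: complex \<Rightarrow> real) = density lborel (\<lambda>r. ennreal (2 * pi * r) * indicator {0..} r)"
proof (rule measure_eqI_Iio)
  fix x :: real
  have 1: "emeasure (distr lborel borel (norm :: complex \<Rightarrow> real)) {..<x} = ennreal (pi * (max 0 x)\<^sup>2)"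
    using emeasure_lborel_norm_less[of x] by (simp add: emeasure_distr vimage_def)
  have "emeasure (density lborel (\<lambda>r. ennreal (2 * pi * r) * indicator {0..} r)) {..<x}
     = (\<integral>\<^sup>+r. ennreal (2 * pi * r) * indicator {0..max 0 x} r \<partial>lborel)"
  proof (subst emeasure_density)
    \<comment> \<open>Adding the null end point \<open>x\<close> gives a compact interval for the
      fundamental theorem.\<close>
    have "AE r in lborel. r \<noteq> x" by (rule AE_lborel_singleton)
    then show "(\<integral>\<^sup>+r. ennreal (2 * pi * r) * indicator {0..} r * indicator {..<x} r \<partial>lborel)
       = (\<integral>\<^sup>+r. ennreal (2 * pi * r) * indicator {0..max 0 x} r \<partial>lborel)"
      by (intro nn_integral_cong_AE) (auto simp: indicator_def max_def)
  qed auto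
  also have "\<dots> = ennreal (pi * (max 0 x)\<^sup>2 - pi * 0\<^sup>2)"
    by (intro nn_integral_FTC_Icc[where F = "\<lambda>r. pi * r\<^sup>2"]) (auto intro!: derivative_eq_intros)
  finally show "emeasure (distr lborel borel (norm :: complex \<Rightarrow> real)) {..<x} = emeasure (density lborel (\<lambda>r. ennreal (2 * pi * r) * indicator {0..} r)) {..<x}"
    using 1 by simp
  show "emeasure (distr lborel borel (norm :: complex \<Rightarrow> real)) {..<x} < \<infinity>"
    unfolding 1 by simp
qed simp_all

text \<open>In terms of the squared radius the area of a disc is linear, so the density is constant.
  This is why beta densities arise for \<open>(norm z)\<^sup>2\<close> rather than for
  \<open>norm z\<close>.\<close>

lemma distr_lborel_norm_sq:
  "distr lborel borel (\<lambda>z :: complex. (norm z)\<^sup>2) = density lborel (\<lambda>t. ennreal pi * indicator {0..} t)"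
proof (rule measure_eqI_Iio)
  fix x :: real
  have "(norm z)\<^sup>2 < x \<longleftrightarrow> norm z < sqrt x" for z :: complex
    by (metis abs_norm_cancel real_sqrt_abs real_sqrt_less_iff)
  then have 1: "emeasure (distr lborel borel (\<lambda>z :: complex. (norm z)\<^sup>2)) {..<x} = ennreal (pi * max 0 x)"
    using emeasure_lborel_norm_less[of "sqrt x"] by (simp add: emeasure_distr vimage_def max_def not_le)
  have "emeasure (density lborel (\<lambda>r. ennreal pi * indicator {0..} r)) {..<x}
     = (\<integral>\<^sup>+r. ennreal pi * indicator {0..<x} r \<partial>lborel)"
    by (subst emeasure_density) (auto intro!: nn_integral_cong simp: indicator_def)
  also have "\<dots> = ennreal (pi * max 0 x)"
    by (subst nn_integral_cmult_indicator) (auto simp: ennreal_mult[symmetric] max_def)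
  finally show "emeasure (distr lborel borel (\<lambda>z :: complex. (norm z)\<^sup>2)) {..<x} = emeasure (density lborel (\<lambda>r. ennreal pi * indicator {0..} r)) {..<x}"
    using 1 by simp
  show "emeasure (distr lborel borel (\<lambda>z :: complex. (norm z)\<^sup>2)) {..<x} < \<infinity>"
    unfolding 1 by simp
qed simp_all

lemma nn_integral_lborel_norm:
  assumes [measurable]: "f \<in> borel_measurable borel"
  shows "(\<integral>\<^sup>+z. f (norm (z::complex)) \<partial>lborel) = (\<integral>\<^sup>+r. ennreal (2 * pi * r) * indicator {0..} r * f r \<partial>lborel)"
  using nn_integral_distr[of norm "lborel :: complex measure" borel f]
  by (simp add: distr_lborel_norm nn_integral_density)

lemma nn_integral_lborel_norm_sq:
  assumes [measurable]: "f \<in> borel_measurable borel"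
  shows "(\<integral>\<^sup>+z. f ((norm (z::complex))\<^sup>2) \<partial>lborel) = (\<integral>\<^sup>+t. ennreal pi * indicator {0..} t * f t \<partial>lborel)"
  using nn_integral_distr[of "\<lambda>z. (norm z)\<^sup>2" "lborel :: complex measure" borel f]
  by (simp add: distr_lborel_norm_sq nn_integral_density)

lemma nn_integral_lborel_complex_scale:
  fixes f :: "complex \<Rightarrow> ennreal"
  assumes [measurable]: "f \<in> borel_measurable borel" and a: "a > 0"
  shows "(\<integral>\<^sup>+z. f z \<partial>lborel) = ennreal (a\<^sup>2) * (\<integral>\<^sup>+z. f (of_real a * z) \<partial>lborel)"
  by (subst lborel_affine[of a 0])
     (use a in \<open>simp_all add: nn_integral_density nn_integral_distr nn_integral_cmult scaleR_conv_of_real\<close>)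

subsection \<open>The weights\<close>

lemma weight1_measurable [measurable]: "weight1 l \<in> borel_measurable borel"
  unfolding weight1_def by measurable

lemma weight_measurable [measurable]: "weight m l \<in> borel_measurable borel"
proof (induction m)
  case (Suc m)
  show ?case
  proof (cases m)
    case (Suc p)
    have [measurable]: "weight (Suc p) l \<in> borel_measurable borel"
      using Suc.IH unfolding Suc .
    show ?thesis unfolding Suc weight.simps by measurable
  qed (simp cong: measurable_cong)
qed (simp cong: measurable_cong)

lemma weight_eq_0: "s \<ge> 1 \<Longrightarrow> weight m l s = 0"
  by (cases "(m, l, s)" rule: weight.cases) (auto simp: weight1_def)

text \<open>With \<open>t = (norm z)\<^sup>2\<close> the factor \<open>pi\<close> cancels against
  \<open>l / pi\<close>, and \<open>l * t ^ (j - 1) * (1 - t) ^ (l - 1)\<close> remains in front of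
  \<open>h t\<close>: the beta density without its normalisation, times \<open>l\<close>.\<close>

lemma nn_integral_norm_weight1:
  assumes [measurable]: "h \<in> borel_measurable borel" and "j \<ge> 1" "l \<ge> 1"
  shows "(\<integral>\<^sup>+z. h ((norm (z::complex))\<^sup>2) * ennreal (norm z ^ (2 * (j - 1))) * ennreal (weight1 l (norm z)) \<partial>lborel)
    = ennreal (real l * Beta (real j) (real l)) * (\<integral>\<^sup>+t. ennreal (beta_pdf j l t) * h t \<partial>lborel)"
proof -
  have B: "Beta (real j) (real l) > 0" using assms(2,3)
    unfolding Beta_def by (auto intro!: divide_pos_pos mult_pos_pos Gamma_real_pos)
  have [measurable]: "beta_pdf j l \<in> borel_measurable borel" unfolding beta_pdf_def by measurable
  let ?f = "\<lambda>t. h t * ennreal (t ^ (j - 1)) * ennreal (real l / pi * (1 - t) ^ (l - 1) * indicator {0..<1} t)"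
  have "(\<integral>\<^sup>+z. h ((norm (z::complex))\<^sup>2) * ennreal (norm z ^ (2 * (j - 1))) * ennreal (weight1 l (norm z)) \<partial>lborel)
     = (\<integral>\<^sup>+z. ?f ((norm (z::complex))\<^sup>2) \<partial>lborel)"
    by (intro nn_integral_cong) (auto simp: weight1_def power_mult indicator_def abs_square_less_1)
  also have "\<dots> = (\<integral>\<^sup>+t. ennreal pi * indicator {0..} t * ?f t \<partial>lborel)"
    by (rule nn_integral_lborel_norm_sq) measurable
  also have "\<dots> = (\<integral>\<^sup>+t. ennreal (real l * Beta (real j) (real l)) * (ennreal (beta_pdf j l t) * h t) \<partial>lborel)"
  proof (rule nn_integral_cong_AE)
    \<comment> \<open>At \<open>t = 1\<close> the two sides may differ: the weight vanishes there,
      while for \<open>l = 1\<close> the beta density does not.\<close>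
    have "AE t in lborel. t \<noteq> (1::real)" by (rule AE_lborel_singleton)
    then show "AE t in lborel. ennreal pi * indicator {0..} t * ?f t
       = ennreal (real l * Beta (real j) (real l)) * (ennreal (beta_pdf j l t) * h t)"
    proof eventually_elim
      case (elim t)
      show ?case
      proof (cases "0 \<le> t \<and> t < 1")
        case True
        have K: "ennreal pi * (ennreal (t ^ (j - 1)) * ennreal (real l / pi * (1 - t) ^ (l - 1)))
          = ennreal (real l * Beta (real j) (real l)) * ennreal (beta_pdf j l t)"
          using True B by (simp add: beta_pdf_def ennreal_mult'[symmetric])
        show ?thesis using arg_cong[OF K, of "\<lambda>x. h t * x"] True by (simp add: mult_ac)
      next
        case False
        then show ?thesis using elim by (auto simp: beta_pdf_def indicator_def)
      qed
    qed
  qed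
  also have "\<dots> = ennreal (real l * Beta (real j) (real l)) * (\<integral>\<^sup>+t. ennreal (beta_pdf j l t) * h t \<partial>lborel)"
    by (rule nn_integral_cmult) measurable
  finally show ?thesis .
qed

text \<open>The recursion for the weights is a multiplicative convolution on the punctured plane.\<close>

lemma nn_integral_weight_Suc:
  fixes h :: "real \<Rightarrow> ennreal"
  assumes [measurable]: "h \<in> borel_measurable borel"
  shows "(\<integral>\<^sup>+z. h ((norm (z::complex))\<^sup>2) * ennreal (norm z ^ (2 * k)) * weight (Suc (Suc m)) l (norm z) \<partial>lborel)
    = (\<integral>\<^sup>+v. (\<integral>\<^sup>+z. h ((norm (v::complex))\<^sup>2 * (norm (z::complex))\<^sup>2) * ennreal (norm z ^ (2 * k)) * weight (Suc m) l (norm z) \<partial>lborel)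
         * ennreal (norm v ^ (2 * k)) * ennreal (weight1 (l (Suc (Suc m))) (norm v)) \<partial>lborel)"
proof -
  let ?w = "\<lambda>u. weight1 (l (Suc (Suc m))) u" and ?W = "weight (Suc m) l"
  let ?H = "\<lambda>r. h (r\<^sup>2) * ennreal (r ^ (2 * k))"
  let ?I = "indicator {0<..<1} :: real \<Rightarrow> ennreal"
  have w: "weight (Suc (Suc m)) l (norm z) = ennreal (2 * pi) *
        (\<integral>\<^sup>+u. (ennreal (?w u) * ?W (norm z / u) * ennreal (1 / u)) * ?I u \<partial>lborel)" for z :: complex
  proof (cases "norm z < 1")
    case False
    have "(\<integral>\<^sup>+u. (ennreal (?w u) * ?W (norm z / u) * ennreal (1 / u)) * ?I u \<partial>lborel) = (\<integral>\<^sup>+(u::real). 0 \<partial>lborel)"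
    proof (rule nn_integral_cong)
      fix u :: real
      show "(ennreal (?w u) * ?W (norm z / u) * ennreal (1 / u)) * ?I u = 0"
      proof (cases "u \<in> {0<..<1}")
        case True
        then have "norm z / u \<ge> 1" using False by (simp add: field_simps)
        then show ?thesis by (simp add: weight_eq_0)
      qed simp
    qed
    then show ?thesis using False by simp
  qed simp
  have "(\<integral>\<^sup>+z. ?H (norm (z::complex)) * weight (Suc (Suc m)) l (norm z) \<partial>lborel)
    = (\<integral>\<^sup>+z. (\<integral>\<^sup>+u. ?H (norm (z::complex)) * ennreal (2 * pi) * ((ennreal (?w u) * ?W (norm z / u) * ennreal (1 / u)) * ?I u) \<partial>lborel) \<partial>lborel)"
    unfolding w by (subst nn_integral_cmult) (auto simp: mult.assoc)
  also have "\<dots> = (\<integral>\<^sup>+u. (\<integral>\<^sup>+z. ?H (norm (z::complex)) * ennreal (2 * pi) * ((ennreal (?w u) * ?W (norm z / u) * ennreal (1 / u)) * ?I u) \<partial>lborel) \<partial>lborel)"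
    by (rule lborel_pair.Fubini') measurable
  \<comment> \<open>For fixed \<open>u\<close> the substitution \<open>z \<mapsto> u * z\<close>
    contributes \<open>u\<^sup>2\<close>. Together with \<open>2 * pi\<close> and
    \<open>1 / u\<close> from the recursion this leaves \<open>2 * pi * u\<close>, the radial
    density, so \<open>u\<close> can be read as the modulus of a second complex variable
    \<open>v\<close>.\<close>
  also have "\<dots> = (\<integral>\<^sup>+u. ennreal (2 * pi * u) * indicator {0..} u * (ennreal (?w u) * (\<integral>\<^sup>+z. ?H (u * norm (z::complex)) * ?W (norm z) \<partial>lborel)) \<partial>lborel)"
  proof (rule nn_integral_cong)
    fix u :: real
    show "(\<integral>\<^sup>+z. ?H (norm (z::complex)) * ennreal (2 * pi) * ((ennreal (?w u) * ?W (norm z / u) * ennreal (1 / u)) * ?I u) \<partial>lborel)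
      = ennreal (2 * pi * u) * indicator {0..} u * (ennreal (?w u) * (\<integral>\<^sup>+z. ?H (u * norm (z::complex)) * ?W (norm z) \<partial>lborel))"
    proof (cases "u \<in> {0<..<1}")
      case False
      \<comment> \<open>Off the open unit interval \<open>weight1\<close> vanishes except at
        \<open>u = 0\<close>, where the factor \<open>2 * pi * u\<close> does.\<close>
      then show ?thesis by (cases "u = 0") (auto simp: weight1_def indicator_def)
    next
      case True
      then have u: "u > 0" "u < 1" by auto
      have "(\<integral>\<^sup>+z. ?H (norm (z::complex)) * ennreal (2 * pi) * ((ennreal (?w u) * ?W (norm z / u) * ennreal (1 / u)) * ?I u) \<partial>lborel)
         = (\<integral>\<^sup>+z. ennreal (2 * pi) * ennreal (?w u) * ennreal (1 / u) * (?H (norm (z::complex)) * ?W (norm z / u)) \<partial>lborel)"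
        using True by (intro nn_integral_cong) (simp add: mult_ac)
      also have "\<dots> = ennreal (2 * pi) * ennreal (?w u) * ennreal (1 / u) * (\<integral>\<^sup>+z. ?H (norm (z::complex)) * ?W (norm z / u) \<partial>lborel)"
        by (rule nn_integral_cmult) measurable
      also have "(\<integral>\<^sup>+z. ?H (norm (z::complex)) * ?W (norm z / u) \<partial>lborel)
         = ennreal (u\<^sup>2) * (\<integral>\<^sup>+z. ?H (norm (of_real u * z :: complex)) * ?W (norm (of_real u * z :: complex) / u) \<partial>lborel)"
        using u by (intro nn_integral_lborel_complex_scale) measurable
      also have "\<dots> = ennreal (u\<^sup>2) * (\<integral>\<^sup>+z. ?H (u * norm (z::complex)) * ?W (norm z) \<partial>lborel)"
        using u by (simp add: norm_mult)
      also have "ennreal (2 * pi) * ennreal (?w u) * ennreal (1 / u) * (ennreal (u\<^sup>2) * (\<integral>\<^sup>+z. ?H (u * norm (z::complex)) * ?W (norm z) \<partial>lborel))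
        = (ennreal (2 * pi) * ennreal (1 / u) * ennreal (u\<^sup>2)) * (ennreal (?w u) * (\<integral>\<^sup>+z. ?H (u * norm (z::complex)) * ?W (norm z) \<partial>lborel))"
        by (simp only: mult_ac)
      also have "ennreal (2 * pi) * ennreal (1 / u) * ennreal (u\<^sup>2) = ennreal (2 * pi * u) * indicator {0..} u"
        using u by (simp add: ennreal_mult'[symmetric] power2_eq_square)
      finally show ?thesis .
    qed
  qed
  also have "\<dots> = (\<integral>\<^sup>+v. ennreal (?w (norm v)) * (\<integral>\<^sup>+z. ?H (norm (v::complex) * norm (z::complex)) * ?W (norm z) \<partial>lborel) \<partial>lborel)"
    by (rule nn_integral_lborel_norm[symmetric]) measurable
  also have "\<dots> = (\<integral>\<^sup>+v. (\<integral>\<^sup>+z. h ((norm (v::complex))\<^sup>2 * (norm (z::complex))\<^sup>2) * ennreal (norm z ^ (2 * k)) * weight (Suc m) l (norm z) \<partial>lborel)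
         * ennreal (norm v ^ (2 * k)) * ennreal (weight1 (l (Suc (Suc m))) (norm v)) \<partial>lborel)"
  proof (rule nn_integral_cong)
    fix v :: complex
    have "(\<integral>\<^sup>+z. ?H (norm v * norm (z::complex)) * ?W (norm z) \<partial>lborel)
      = (\<integral>\<^sup>+z. (h ((norm (v::complex))\<^sup>2 * (norm (z::complex))\<^sup>2) * ennreal (norm z ^ (2 * k)) * ?W (norm z)) * ennreal (norm v ^ (2 * k)) \<partial>lborel)"
      by (intro nn_integral_cong) (simp add: power_mult_distrib ennreal_mult mult_ac)
    also have "\<dots> = (\<integral>\<^sup>+z. (h ((norm (v::complex))\<^sup>2 * (norm (z::complex))\<^sup>2) * ennreal (norm z ^ (2 * k)) * ?W (norm z)) \<partial>lborel) * ennreal (norm v ^ (2 * k))"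
      by (rule nn_integral_multc) measurable
    finally show "ennreal (?w (norm v)) * (\<integral>\<^sup>+z. ?H (norm v * norm (z::complex)) * ?W (norm z) \<partial>lborel)
       = (\<integral>\<^sup>+z. h ((norm (v::complex))\<^sup>2 * (norm (z::complex))\<^sup>2) * ennreal (norm z ^ (2 * k)) * weight (Suc m) l (norm z) \<partial>lborel)
         * ennreal (norm v ^ (2 * k)) * ennreal (weight1 (l (Suc (Suc m))) (norm v))"
      by (simp add: mult_ac)
  qed
  finally show ?thesis .
qed

text \<open>Induction on \<open>m\<close>, each new factor multiplying the constant by
  \<open>l r * Beta j (l r)\<close>. All test functions are covered at once because the step applies
  the hypothesis to \<open>h\<close> rescaled by \<open>(norm v)\<^sup>2\<close>, with
  \<open>v\<close> the variable of the new factor.\<close>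

lemma nn_integral_norm_weight:
  fixes s :: "nat \<Rightarrow> 'b \<Rightarrow> real"
  assumes "prob_space N" and "j \<ge> 1" and "m \<ge> 1"
    and l: "\<And>r. r \<in> {1..m} \<Longrightarrow> l r \<ge> 1"
    and "prob_space.indep_vars N (\<lambda>_. borel) s {1..m}"
    and s: "\<And>r. r \<in> {1..m} \<Longrightarrow> distributed N lborel (s r) (\<lambda>y. ennreal (beta_pdf j (l r) y))"
  shows "\<exists>c>0. \<forall>h\<in>borel_measurable borel.
    (\<integral>\<^sup>+z. h ((norm (z::complex))\<^sup>2) * ennreal (norm z ^ (2 * (j - 1))) * weight m l (norm z) \<partial>lborel)
      = ennreal c * (\<integral>\<^sup>+\<omega>. h (\<Prod>r\<in>{1..m}. s r \<omega>) \<partial>N)"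
proof -
  interpret prob_space N by fact
  have B: "real (l r) * Beta (real j) (real (l r)) > 0" if "r \<in> {1..m}" for r
    using assms(2) l[OF that]
    unfolding Beta_def by (auto intro!: mult_pos_pos divide_pos_pos Gamma_real_pos)
  have one: "(\<integral>\<^sup>+z. h ((norm (z::complex))\<^sup>2) * ennreal (norm z ^ (2 * (j - 1))) * ennreal (weight1 (l r) (norm z)) \<partial>lborel)
     = ennreal (real (l r) * Beta (real j) (real (l r))) * (\<integral>\<^sup>+\<omega>. h (s r \<omega>) \<partial>N)"
    if r: "r \<in> {1..m}" and [measurable]: "h \<in> borel_measurable borel" for r and h :: "real \<Rightarrow> ennreal"
    by (subst nn_integral_norm_weight1) (use assms(2) l[OF r] s[OF r] in \<open>auto simp: distributed_nn_integral\<close>)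
  show ?thesis
    using assms(3,5) l s B one
  proof (induction m rule: nat_induct_at_least)
    case base
    have "weight 1 l x = ennreal (weight1 (l 1) x)" for x
      by (simp only: One_nat_def weight.simps)
    with base show ?case
      by (intro exI[of _ "real (l 1) * Beta (real j) (real (l 1))"])
         (auto simp: One_nat_def[symmetric] simp del: One_nat_def)
  next
    case (Suc m)
    then obtain p where p: "m = Suc p" by (cases m) auto
    have sub: "{1..m} \<subseteq> {1..Suc m}" by auto
    have "\<exists>c>0. \<forall>h\<in>borel_measurable borel.
      (\<integral>\<^sup>+z. h ((norm (z::complex))\<^sup>2) * ennreal (norm z ^ (2 * (j - 1))) * weight m l (norm z) \<partial>lborel)
      = ennreal c * (\<integral>\<^sup>+\<omega>. h (\<Prod>r\<in>{1..m}. s r \<omega>) \<partial>N)"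
      using Suc.prems sub by (intro Suc.IH) (auto intro: indep_vars_subset)
    then obtain c where c: "c > 0" and IH: "\<And>h. h \<in> borel_measurable borel \<Longrightarrow>
      (\<integral>\<^sup>+z. h ((norm (z::complex))\<^sup>2) * ennreal (norm z ^ (2 * (j - 1))) * weight m l (norm z) \<partial>lborel)
      = ennreal c * (\<integral>\<^sup>+\<omega>. h (\<Prod>r\<in>{1..m}. s r \<omega>) \<partial>N)" by blast
    let ?b = "real (l (Suc m)) * Beta (real j) (real (l (Suc m)))"
    let ?Y = "\<lambda>\<omega>. \<Prod>r\<in>{1..m}. s r \<omega>"
    have eq: "{1..Suc m} = insert (Suc m) {1..m}" by auto
    have "indep_vars (\<lambda>_. borel) s (insert (Suc m) {1..m})" using Suc.prems(1) unfolding eq .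
    then have iv: "indep_var borel (s (Suc m)) borel ?Y" by (intro indep_vars_prod) auto
    have [measurable]: "s (Suc m) \<in> borel_measurable N" "?Y \<in> borel_measurable N"
      using indep_var_rv1[OF iv] indep_var_rv2[OF iv] by auto
    interpret D: prob_space "distr N borel ?Y" by (rule prob_space_distr) fact
    show ?case
    proof (intro exI[of _ "c * ?b"] conjI ballI)
      show "c * ?b > 0" using c Suc.prems(4)[of "Suc m"] by simp
      fix h :: "real \<Rightarrow> ennreal" assume [measurable]: "h \<in> borel_measurable borel"
      \<comment> \<open>\<open>?h x\<close> averages \<open>h\<close> over \<open>x\<close> times
        the product of the first \<open>m\<close> variables. As a function of \<open>x\<close> alone
        it is a test function for the single-factor identity \<open>one\<close>.\<close>
      let ?h = "\<lambda>x. \<integral>\<^sup>+y. h (x * y) \<partial>distr N borel ?Y"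
      have [measurable]: "?h \<in> borel_measurable borel" by measurable
      have "(\<integral>\<^sup>+z. h ((norm (z::complex))\<^sup>2) * ennreal (norm z ^ (2 * (j - 1))) * weight (Suc m) l (norm z) \<partial>lborel)
        = (\<integral>\<^sup>+v. (\<integral>\<^sup>+z. h ((norm (v::complex))\<^sup>2 * (norm (z::complex))\<^sup>2) * ennreal (norm z ^ (2 * (j - 1))) * weight m l (norm z) \<partial>lborel)
         * ennreal (norm v ^ (2 * (j - 1))) * ennreal (weight1 (l (Suc m)) (norm v)) \<partial>lborel)"
        unfolding p by (rule nn_integral_weight_Suc) simp
      also have "\<dots> = (\<integral>\<^sup>+v. (ennreal c * ?h ((norm (v::complex))\<^sup>2))
         * ennreal (norm v ^ (2 * (j - 1))) * ennreal (weight1 (l (Suc m)) (norm v)) \<partial>lborel)"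
        by (subst IH) (auto simp: nn_integral_distr simp del: One_nat_def)
      also have "\<dots> = ennreal ?b * (\<integral>\<^sup>+\<omega>. ennreal c * ?h (s (Suc m) \<omega>) \<partial>N)"
        by (rule Suc.prems(5)[of "Suc m" "\<lambda>x. ennreal c * ?h x"]) (simp, measurable)
      also have "\<dots> = ennreal ?b * (ennreal c * (\<integral>\<^sup>+\<omega>. ?h (s (Suc m) \<omega>) \<partial>N))"
        by (intro arg_cong2[where f = "(*)"] refl nn_integral_cmult) measurable
      also have "(\<integral>\<^sup>+\<omega>. ?h (s (Suc m) \<omega>) \<partial>N) = (\<integral>\<^sup>+x. ?h x \<partial>distr N borel (s (Suc m)))"
        by (rule nn_integral_distr[symmetric]) measurable
      also have "\<dots> = (\<integral>\<^sup>+p. h (fst p * snd p) \<partial>(distr N borel (s (Suc m)) \<Otimes>\<^sub>M distr N borel ?Y))"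
        by (subst D.nn_integral_fst[symmetric]) auto
      \<comment> \<open>Independence enters here: the product of the two laws is the joint
        law.\<close>
      also have "distr N borel (s (Suc m)) \<Otimes>\<^sub>M distr N borel ?Y = distr N (borel \<Otimes>\<^sub>M borel) (\<lambda>\<omega>. (s (Suc m) \<omega>, ?Y \<omega>))"
        using iv by (simp add: indep_var_distribution_eq)
      also have "(\<integral>\<^sup>+p. h (fst p * snd p) \<partial>distr N (borel \<Otimes>\<^sub>M borel) (\<lambda>\<omega>. (s (Suc m) \<omega>, ?Y \<omega>))) = (\<integral>\<^sup>+\<omega>. h (\<Prod>r\<in>{1..Suc m}. s r \<omega>) \<partial>N)"
        unfolding eq by (subst nn_integral_distr) (auto simp del: One_nat_def)
      finally show "(\<integral>\<^sup>+z. h ((norm (z::complex))\<^sup>2) * ennreal (norm z ^ (2 * (j - 1))) * weight (Suc m) l (norm z) \<partial>lborel)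
        = ennreal (c * ?b) * (\<integral>\<^sup>+\<omega>. h (\<Prod>r\<in>{1..Suc m}. s r \<omega>) \<partial>N)"
        using c Suc.prems(4)[of "Suc m"] by (simp add: ennreal_mult mult_ac)
    qed
  qed
qed

subsection \<open>Cancellation of the cross terms\<close>

lemma cnj_measurable [measurable]: "cnj \<in> borel_measurable borel"
  by (intro borel_measurable_continuous_onI continuous_intros)

text \<open>With \<open>pi / 3\<close> divided by the distance of \<open>a\<close> and
  \<open>b\<close> as angle, the product is a rotation by plus or minus \<open>pi / 3\<close>, whose
  real part is 1/2. The angle is at most \<open>pi / 3\<close>, so \<open>Re c\<close> is
  positive.\<close>

lemma exists_rotation_not_fixed:
  assumes "a \<noteq> b"
  obtains c :: complex where "norm c = 1" "Re c \<noteq> 0" "c ^ a * cnj c ^ b \<noteq> 1"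
proof -
  define d where "d = \<bar>int a - int b\<bar>"
  have d: "d \<ge> 1" using assms by (auto simp: d_def)
  define t where "t = pi / (3 * real_of_int d)"
  have t0: "t > 0" using d by (simp add: t_def)
  have t1: "t \<le> pi / 3" unfolding t_def using d by (simp add: field_simps)
  have "cos t > 0" using t0 t1 pi_gt_zero by (intro cos_gt_zero) linarith+
  moreover have "cis t ^ a * cnj (cis t) ^ b = cis (real a * t - real b * t)"
    by (simp only: cis_cnj Complex.DeMoivre cis_mult) simp
  moreover have "Re (cis (real a * t - real b * t)) = cos (pi / 3)"
  proof -
    have "\<bar>real a * t - real b * t\<bar> = real_of_int d * t"
      using t0 by (simp add: d_def left_diff_distrib[symmetric] abs_mult)
    also have "\<dots> = pi / 3" using d by (simp add: t_def)
    finally have "cos \<bar>real a * t - real b * t\<bar> = cos (pi / 3)" by (rule arg_cong)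
    then show ?thesis by (simp only: cos_abs_real cis.sel)
  qed
  then have "cis (real a * t - real b * t) \<noteq> 1"
    by (auto dest: arg_cong[where f = Re] simp: cos_60 simp del: cis.sel)
  ultimately show ?thesis by (intro that[of "cis t"]) auto
qed

text \<open>\<open>F\<close> stands for the indicator of an event for the symmetric function, cut to
  the open unit polydisc. \<open>F_disc\<close> keeps all monomials bounded, \<open>F_rot\<close>
  says that \<open>F\<close> depends on moduli only, and \<open>rot\<close> has the restriction of
  \<open>nn_integral_lborel_rotate\<close>.\<close>

locale radial_product =
  fixes \<mu> :: "complex measure" and n :: nat and F :: "(nat \<Rightarrow> complex) \<Rightarrow> real" and B :: real
  assumes prob: "prob_space \<mu>"
    and sets_mu [measurable_cong]: "sets \<mu> = sets borel"
    and rot: "norm c = 1 \<Longrightarrow> Re c \<noteq> 0 \<Longrightarrow> distr \<mu> borel (\<lambda>z. c * z) = \<mu>"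
    and F_measurable [measurable]: "F \<in> borel_measurable (\<Pi>\<^sub>M j\<in>{1..n}. borel)"
    and F_bounded: "\<bar>F z\<bar> \<le> B"
    and F_disc: "j \<in> {1..n} \<Longrightarrow> norm (z j) \<ge> 1 \<Longrightarrow> F z = 0"
    and F_rot: "norm c = 1 \<Longrightarrow> F (z(j := c * z j)) = F z"
    and F_sym: "\<sigma> permutes {1..n} \<Longrightarrow> z \<in> extensional {1..n} \<Longrightarrow> F (\<lambda>j\<in>{1..n}. z (\<sigma> j)) = F z"
begin

abbreviation Q :: "(nat \<Rightarrow> complex) measure" where
  "Q \<equiv> \<Pi>\<^sub>M j\<in>{1..n}. \<mu>"

sublocale mu: prob_space \<mu> by (rule prob)
sublocale P: product_sigma_finite "\<lambda>_. \<mu>" by unfold_locales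
sublocale Q: prob_space Q by (intro prob_space_PiM prob)

lemma space_mu [simp]: "space \<mu> = UNIV"
  using sets_eq_imp_space_eq[OF sets_mu] by simp

lemma rotate_measurable:
  assumes j: "j \<in> {1..n}"
  shows "(\<lambda>z. z(j := c * z j)) \<in> Q \<rightarrow>\<^sub>M Q"
proof (rule measurable_PiM_single')
  fix i assume "i \<in> {1..n}"
  then show "(\<lambda>z. (z(j := c * z j)) i) \<in> Q \<rightarrow>\<^sub>M \<mu>"
    using j by (cases "i = j") auto
qed (use j in \<open>auto simp: space_PiM PiE_def extensional_def\<close>)

text \<open>The preimage of a rectangle is a rectangle with a single side replaced, so invariance of
  one factor suffices.\<close>

lemma Q_rotate:
  assumes j: "j \<in> {1..n}" and c: "norm c = 1" "Re c \<noteq> 0"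
  shows "distr Q Q (\<lambda>z. z(j := c * z j)) = Q"
proof (rule P.PiM_eqI)
  note [measurable] = rotate_measurable[OF j]
  fix A :: "nat \<Rightarrow> complex set" assume A: "\<And>i. i \<in> {1..n} \<Longrightarrow> A i \<in> sets \<mu>"
  have m: "(\<lambda>z. c * z) \<in> \<mu> \<rightarrow>\<^sub>M borel" by measurable
  let ?A = "A(j := (\<lambda>z. c * z) -` A j)"
  have sA: "?A i \<in> sets \<mu>" if "i \<in> {1..n}" for i
    using A[OF that] measurable_sets[OF m, of "A j"] A[OF j] by (auto simp: sets_mu)
  have "(\<lambda>z. z(j := c * z j)) -` (\<Pi>\<^sub>E i\<in>{1..n}. A i) \<inter> space Q = (\<Pi>\<^sub>E i\<in>{1..n}. ?A i)"
    using j by (auto simp: space_PiM PiE_def Pi_def extensional_def split: if_splits)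
  then have "emeasure (distr Q Q (\<lambda>z. z(j := c * z j))) (\<Pi>\<^sub>E i\<in>{1..n}. A i) = emeasure Q (\<Pi>\<^sub>E i\<in>{1..n}. ?A i)"
    using A by (subst emeasure_distr[OF rotate_measurable[OF j]]) (auto intro!: sets_PiM_I_finite simp del: One_nat_def fun_upd_apply)
  also have "\<dots> = (\<Prod>i\<in>{1..n}. emeasure \<mu> (?A i))"
    using sA by (intro P.emeasure_PiM) auto
  also have "\<dots> = (\<Prod>i\<in>{1..n}. emeasure \<mu> (A i))"
  proof (intro prod.cong refl)
    fix i
    have "emeasure \<mu> ((\<lambda>z. c * z) -` A j) = emeasure (distr \<mu> borel (\<lambda>z. c * z)) (A j)"
      using A[OF j] by (subst emeasure_distr) (auto simp: sets_mu)
    then show "emeasure \<mu> (?A i) = emeasure \<mu> (A i)" using rot[OF c] by auto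
  qed
  finally show "emeasure (distr Q Q (\<lambda>z. z(j := c * z j))) (\<Pi>\<^sub>E i\<in>{1..n}. A i) = (\<Prod>i\<in>{1..n}. emeasure \<mu> (A i))" .
qed auto

text \<open>The exponents of \<open>z\<close> and \<open>cnj z\<close> are separate because the two
  permutations of the expansion vary independently; \<open>F\<close> is included for
  integrability.\<close>

definition monomial :: "(nat \<Rightarrow> nat) \<Rightarrow> (nat \<Rightarrow> nat) \<Rightarrow> (nat \<Rightarrow> complex) \<Rightarrow> complex" where
  "monomial a b z = of_real (F z) * (\<Prod>j\<in>{1..n}. z j ^ a j * cnj (z j) ^ b j)"

lemma monomial_measurable [measurable]: "monomial a b \<in> borel_measurable Q"
  unfolding monomial_def by measurable

text \<open>Inside the polydisc every factor has modulus at most 1 and outside it \<open>F\<close>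
  vanishes, so \<open>B\<close> bounds the whole function on a probability space.\<close>

lemma monomial_integrable: "integrable Q (monomial a b)"
proof (rule Q.integrable_const_bound[of _ B])
  have "norm (monomial a b z) \<le> B" for z
  proof (cases "\<exists>j\<in>{1..n}. norm (z j) \<ge> 1")
    case True
    then have "F z = 0" using F_disc by blast
    moreover have "B \<ge> 0" using F_bounded[of z] by linarith
    ultimately show ?thesis by (simp add: monomial_def)
  next
    case False
    have "norm (\<Prod>j\<in>{1..n}. z j ^ a j * cnj (z j) ^ b j) = (\<Prod>j\<in>{1..n}. norm (z j) ^ a j * norm (z j) ^ b j)"
      by (simp add: prod_norm[symmetric] norm_mult norm_power)
    also have "\<dots> \<le> (\<Prod>j\<in>{1..n}. 1)"
      using False by (intro prod_mono conjI mult_le_one power_le_one) (auto simp: not_le less_imp_le)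
    finally have "norm (\<Prod>j\<in>{1..n}. z j ^ a j * cnj (z j) ^ b j) \<le> 1" by simp
    then have "norm (monomial a b z) \<le> \<bar>F z\<bar> * 1"
      unfolding monomial_def norm_mult norm_of_real by (intro mult_left_mono) auto
    with F_bounded[of z] show ?thesis by linarith
  qed
  then show "AE z in Q. norm (monomial a b z) \<le> B" by simp
qed (fact monomial_measurable)

text \<open>Rotating coordinate \<open>j\<close> by a suitable \<open>c\<close> preserves
  \<open>Q\<close> and \<open>F\<close> but multiplies the monomial by a number other than 1, so the
  integral is a nontrivial multiple of itself.\<close>

lemma integral_monomial_eq_0:
  assumes j: "j \<in> {1..n}" and ab: "a j \<noteq> b j"
  shows "(\<integral>z. monomial a b z \<partial>Q) = 0"
proof -
  obtain c :: complex where c: "norm c = 1" "Re c \<noteq> 0" "c ^ a j * cnj c ^ b j \<noteq> 1"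
    using exists_rotation_not_fixed[OF ab] .
  have "monomial a b (z(j := c * z j)) = (c ^ a j * cnj c ^ b j) * monomial a b z" for z
  proof -
    have "(\<Prod>i\<in>{1..n} - {j}. (z(j := c * z j)) i ^ a i * cnj ((z(j := c * z j)) i) ^ b i) = (\<Prod>i\<in>{1..n} - {j}. z i ^ a i * cnj (z i) ^ b i)"
      by (intro prod.cong) auto
    then show ?thesis
      unfolding monomial_def F_rot[OF c(1)] prod.remove[OF finite_atLeastAtMost j]
      by (simp add: power_mult_distrib mult_ac)
  qed
  moreover have "(\<integral>z. monomial a b z \<partial>Q) = (\<integral>z. monomial a b z \<partial>distr Q Q (\<lambda>z. z(j := c * z j)))"
    using Q_rotate[OF j c(1,2)] by simp
  moreover have "\<dots> = (\<integral>z. monomial a b (z(j := c * z j)) \<partial>Q)"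
    by (rule integral_distr[OF rotate_measurable[OF j] monomial_measurable])
  ultimately have "(\<integral>z. monomial a b z \<partial>Q) = (c ^ a j * cnj c ^ b j) * (\<integral>z. monomial a b z \<partial>Q)"
    by simp
  then show ?thesis using c(3) by (metis mult_cancel_right1)
qed

text \<open>\<open>Q\<close> has equal factors and \<open>F\<close> is symmetric, so coordinates may
  be relabelled. Relabelling by \<open>inv \<sigma>\<close> puts the exponent \<open>e j\<close> on
  coordinate \<open>inv \<sigma> j\<close>, that is, \<open>e (\<sigma> i)\<close> on coordinate
  \<open>i\<close>.\<close>

lemma integral_monomial_permute:
  assumes s: "\<sigma> permutes {1..n}"
  shows "(\<integral>z. monomial (\<lambda>j. e (\<sigma> j)) (\<lambda>j. e (\<sigma> j)) z \<partial>Q) = (\<integral>z. monomial e e z \<partial>Q)"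
proof -
  let ?s = "inv \<sigma>"
  have si: "?s permutes {1..n}" using permutes_inv[OF s] .
  have im: "?s \<in> {1..n} \<rightarrow> {1..n}" using permutes_in_image[OF si] by blast
  have d: "distr Q Q (\<lambda>\<omega>. \<lambda>j\<in>{1..n}. \<omega> (?s j)) = Q"
    using si prob im
    by (intro distr_PiM_reindex[where M = "\<lambda>_. \<mu>" and f = ?s])
       (auto intro: permutes_inj_on simp del: One_nat_def)
  have m: "(\<lambda>\<omega>. \<lambda>j\<in>{1..n}. \<omega> (?s j)) \<in> Q \<rightarrow>\<^sub>M Q"
  proof (rule measurable_restrict)
    fix i assume "i \<in> {1..n}"
    then have "?s i \<in> {1..n}" using im by blast
    then show "(\<lambda>\<omega>. \<omega> (?s i)) \<in> Q \<rightarrow>\<^sub>M \<mu>" by (rule measurable_component_singleton)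
  qed
  have "(\<integral>z. monomial e e z \<partial>Q) = (\<integral>z. monomial e e z \<partial>distr Q Q (\<lambda>\<omega>. \<lambda>j\<in>{1..n}. \<omega> (?s j)))"
    using d by simp
  also have "\<dots> = (\<integral>z. monomial e e (\<lambda>j\<in>{1..n}. z (?s j)) \<partial>Q)"
    using m by (rule integral_distr) (fact monomial_measurable)
  also have "\<dots> = (\<integral>z. monomial (\<lambda>j. e (\<sigma> j)) (\<lambda>j. e (\<sigma> j)) z \<partial>Q)"
  proof (rule Bochner_Integration.integral_cong[OF refl])
    fix z assume "z \<in> space Q"
    then have z: "z \<in> extensional {1..n}" by (auto simp: space_PiM PiE_def)
    have "(\<Prod>j\<in>{1..n}. z j ^ e (\<sigma> j) * cnj (z j) ^ e (\<sigma> j))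
      = (\<Prod>j\<in>{1..n}. z (?s j) ^ e (\<sigma> (?s j)) * cnj (z (?s j)) ^ e (\<sigma> (?s j)))"
      using prod.permute[OF si, of "\<lambda>j. z j ^ e (\<sigma> j) * cnj (z j) ^ e (\<sigma> j)"] by (simp add: o_def)
    also have "\<dots> = (\<Prod>j\<in>{1..n}. z (?s j) ^ e j * cnj (z (?s j)) ^ e j)"
      by (simp add: permutes_inverses[OF s])
    finally show "monomial e e (\<lambda>j\<in>{1..n}. z (?s j)) = monomial (\<lambda>j. e (\<sigma> j)) (\<lambda>j. e (\<sigma> j)) z"
      unfolding monomial_def F_sym[OF si z] by simp
  qed
  finally show ?thesis by simp
qed

lemma norm_vandermonde_sq:
  "of_real (F z * (\<Prod>j\<in>{1..n}. \<Prod>k\<in>{j<..n}. (norm (z j - z k))\<^sup>2))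
   = (\<Sum>\<sigma> | \<sigma> permutes {1..n}. \<Sum>\<tau> | \<tau> permutes {1..n}.
        of_int (sign \<sigma> * sign \<tau>) * monomial (\<lambda>j. \<sigma> j - 1) (\<lambda>j. \<tau> j - 1) z)"
proof -
  let ?V = "\<Prod>j\<in>{1..n}. \<Prod>k\<in>{j<..n}. z k - z j"
  have "complex_of_real (\<Prod>j\<in>{1..n}. \<Prod>k\<in>{j<..n}. (norm (z j - z k))\<^sup>2) = ?V * cnj ?V"
    unfolding of_real_prod cnj_prod prod.distrib[symmetric]
    by (intro prod.cong refl) (simp only: complex_norm_square[symmetric] norm_minus_commute of_real_power)
  also have "\<dots> = (\<Sum>\<sigma> | \<sigma> permutes {1..n}. \<Sum>\<tau> | \<tau> permutes {1..n}.
       (of_int (sign \<sigma>) * (\<Prod>j\<in>{1..n}. z j ^ (\<sigma> j - 1))) * (of_int (sign \<tau>) * (\<Prod>j\<in>{1..n}. cnj (z j) ^ (\<tau> j - 1))))"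
    unfolding vandermonde_sum[symmetric] by (simp add: sum_product)
  finally show ?thesis
    unfolding of_real_mult monomial_def prod.distrib
    by (simp add: sum_distrib_left mult_ac)
qed

text \<open>The integrability claims accompany the identity because it is later transferred to
  integrals of nonnegative extended functions.\<close>

lemma integral_vandermonde:
  shows "integrable Q (\<lambda>z. F z * (\<Prod>j\<in>{1..n}. \<Prod>k\<in>{j<..n}. (norm (z j - z k))\<^sup>2))" (is "integrable Q ?f")
    and "integrable Q (\<lambda>z. F z * (\<Prod>j\<in>{1..n}. norm (z j) ^ (2 * (j - 1))))" (is "integrable Q ?g")
    and "(\<integral>z. F z * (\<Prod>j\<in>{1..n}. \<Prod>k\<in>{j<..n}. (norm (z j - z k))\<^sup>2) \<partial>Q)
     = fact n * (\<integral>z. F z * (\<Prod>j\<in>{1..n}. norm (z j) ^ (2 * (j - 1))) \<partial>Q)"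
proof -
  let ?m = "\<lambda>\<sigma> \<tau>. monomial (\<lambda>j. \<sigma> j - 1) (\<lambda>j. \<tau> j - 1)"
  have g: "complex_of_real (?g z) = monomial (\<lambda>j. j - 1) (\<lambda>j. j - 1) z" for z
  proof -
    have "complex_of_real (norm w ^ (2 * k)) = w ^ k * cnj w ^ k" for w :: complex and k
      by (metis complex_norm_square of_real_power power_mult power_mult_distrib)
    then show ?thesis unfolding monomial_def of_real_mult of_real_prod by simp
  qed
  have "integrable Q (\<lambda>z. complex_of_real (?f z))"
    unfolding norm_vandermonde_sq
    by (intro Bochner_Integration.integrable_sum integrable_mult_right monomial_integrable)
  then show "integrable Q ?f" by (simp only: complex_of_real_integrable_eq)
  have "integrable Q (\<lambda>z. complex_of_real (?g z))"
    unfolding g by (rule monomial_integrable)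
  then show "integrable Q ?g" by (simp only: complex_of_real_integrable_eq)
  have "complex_of_real (\<integral>z. ?f z \<partial>Q) = (\<integral>z. complex_of_real (?f z) \<partial>Q)"
    by (rule integral_complex_of_real[symmetric])
  also have "\<dots> = (\<Sum>\<sigma> | \<sigma> permutes {1..n}. \<Sum>\<tau> | \<tau> permutes {1..n}.
        of_int (sign \<sigma> * sign \<tau>) * (\<integral>z. ?m \<sigma> \<tau> z \<partial>Q))"
    unfolding norm_vandermonde_sq
    by (subst Bochner_Integration.integral_sum,
        intro Bochner_Integration.integrable_sum integrable_mult_right monomial_integrable,
        intro sum.cong refl, subst Bochner_Integration.integral_sum,
        intro integrable_mult_right monomial_integrable, simp)
  also have "\<dots> = (\<Sum>\<sigma> | \<sigma> permutes {1..n}. \<Sum>\<tau> | \<tau> permutes {1..n}.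
        if \<tau> = \<sigma> then (\<integral>z. monomial (\<lambda>j. j - 1) (\<lambda>j. j - 1) z \<partial>Q) else 0)"
  proof (intro sum.cong refl)
    fix \<sigma> \<tau> assume "\<sigma> \<in> {\<sigma>. \<sigma> permutes {1..n}}" "\<tau> \<in> {\<tau>. \<tau> permutes {1..n}}"
    then have s: "\<sigma> permutes {1..n}" and t: "\<tau> permutes {1..n}" by auto
    show "of_int (sign \<sigma> * sign \<tau>) * (\<integral>z. ?m \<sigma> \<tau> z \<partial>Q)
       = (if \<tau> = \<sigma> then (\<integral>z. monomial (\<lambda>j. j - 1) (\<lambda>j. j - 1) z \<partial>Q) else 0)"
    proof (cases "\<tau> = \<sigma>")
      case True
      then show ?thesis using integral_monomial_permute[OF s, of "\<lambda>j. j - 1"] by simp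
    next
      case False
      \<comment> \<open>Distinct permutations of \<open>{1..n}\<close> agree outside this set, so
        they differ inside it. There both values are at least 1, and truncated subtraction of 1
        keeps them apart.\<close>
      then obtain j where j: "\<tau> j \<noteq> \<sigma> j" by auto
      then have jn: "j \<in> {1..n}" using s t by (metis permutes_def)
      then have "\<sigma> j \<in> {1..n}" "\<tau> j \<in> {1..n}"
        using s t by (simp_all only: permutes_in_image)
      then have "\<sigma> j - 1 \<noteq> \<tau> j - 1" using j by auto
      then show ?thesis using False integral_monomial_eq_0[OF jn, of "\<lambda>j. \<sigma> j - 1" "\<lambda>j. \<tau> j - 1"] by simp
    qed
  qed
  also have "\<dots> = of_nat (card {\<sigma>. \<sigma> permutes {1..n}}) * (\<integral>z. monomial (\<lambda>j. j - 1) (\<lambda>j. j - 1) z \<partial>Q)"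
    by (simp add: finite_permutations)
  also have "\<dots> = complex_of_real (fact n * (\<integral>z. ?g z \<partial>Q))"
    unfolding g[symmetric] integral_complex_of_real by (simp add: card_permutations[of _ n])
  finally show "(\<integral>z. ?f z \<partial>Q) = fact n * (\<integral>z. ?g z \<partial>Q)" unfolding of_real_eq_iff .
qed

end

subsection \<open>Products of densities\<close>

lemma emeasure_distr_eq_nn_integral:
  assumes [measurable]: "X \<in> M \<rightarrow>\<^sub>M K" "A \<in> sets K"
  shows "emeasure (distr M K X) A = (\<integral>\<^sup>+\<omega>. indicator A (X \<omega>) \<partial>M)"
  using nn_integral_distr[of X M K "indicator A"] by simp

lemma PiM_density_lborel:
  fixes f :: "nat \<Rightarrow> complex \<Rightarrow> ennreal"
  assumes I: "finite I" and f: "\<And>i. i \<in> I \<Longrightarrow> f i \<in> borel_measurable borel"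
    and p: "\<And>i. i \<in> I \<Longrightarrow> prob_space (density lborel (f i))"
  shows "(\<Pi>\<^sub>M i\<in>I. density lborel (f i)) = density (\<Pi>\<^sub>M i\<in>I. lborel) (\<lambda>x. \<Prod>i\<in>I. f i (x i))"
proof -
  \<comment> \<open>\<open>product_sigma_finite\<close> asks for sigma-finite factors at every
    index, while the hypotheses speak of \<open>I\<close> only; a point mass fills the other
    places.\<close>
  define N where "N = (\<lambda>i. if i \<in> I then density lborel (f i) else return borel 0)"
  have "prob_space (N i)" for i
    unfolding N_def using p by (auto intro: prob_space_return)
  then interpret N: product_sigma_finite N
    by (simp add: product_sigma_finite_def prob_space_imp_sigma_finite)
  interpret L: product_sigma_finite "\<lambda>_::nat. lborel :: complex measure" by unfold_locales
  have m: "(\<lambda>x. \<Prod>i\<in>I. f i (x i)) \<in> borel_measurable (\<Pi>\<^sub>M i\<in>I. lborel)"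
    using f by (intro borel_measurable_prod_ennreal)
      (auto intro!: measurable_compose[OF measurable_component_singleton])
  have "density (\<Pi>\<^sub>M i\<in>I. lborel) (\<lambda>x. \<Prod>i\<in>I. f i (x i)) = PiM I N"
  proof (rule N.PiM_eqI[OF I])
    show "sets (density (\<Pi>\<^sub>M i\<in>I. lborel) (\<lambda>x. \<Prod>i\<in>I. f i (x i))) = sets (PiM I N)"
      unfolding sets_density by (intro sets_PiM_cong) (auto simp: N_def)
    fix A assume A: "\<And>i. i \<in> I \<Longrightarrow> A i \<in> sets (N i)"
    then have A': "A i \<in> sets lborel" if "i \<in> I" for i using that by (auto simp: N_def)
    have "emeasure (density (\<Pi>\<^sub>M i\<in>I. lborel) (\<lambda>x. \<Prod>i\<in>I. f i (x i))) (Pi\<^sub>E I A)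
       = (\<integral>\<^sup>+x. (\<Prod>i\<in>I. f i (x i)) * indicator (Pi\<^sub>E I A) x \<partial>(\<Pi>\<^sub>M i\<in>I. lborel))"
      using A' by (intro emeasure_density m sets_PiM_I_finite I) auto
    also have "\<dots> = (\<integral>\<^sup>+x. (\<Prod>i\<in>I. f i (x i) * indicator (A i) (x i)) \<partial>(\<Pi>\<^sub>M i\<in>I. lborel))"
    proof (rule nn_integral_cong)
      fix x :: "nat \<Rightarrow> complex" assume "x \<in> space (\<Pi>\<^sub>M i\<in>I. lborel)"
      then have "indicator (Pi\<^sub>E I A) x = (\<Prod>i\<in>I. indicator (A i) (x i) :: ennreal)"
        using I by (auto simp: space_PiM indicator_def PiE_iff prod_zero_iff)
      then show "(\<Prod>i\<in>I. f i (x i)) * indicator (Pi\<^sub>E I A) x = (\<Prod>i\<in>I. f i (x i) * indicator (A i) (x i))"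
        by (simp add: prod.distrib)
    qed
    also have "\<dots> = (\<Prod>i\<in>I. \<integral>\<^sup>+x. f i x * indicator (A i) x \<partial>lborel)"
      using f A' by (intro L.product_nn_integral_prod I borel_measurable_times_ennreal) auto
    also have "\<dots> = (\<Prod>i\<in>I. emeasure (N i) (A i))"
      using f A' by (intro prod.cong refl) (auto simp: N_def emeasure_density)
    finally show "emeasure (density (\<Pi>\<^sub>M i\<in>I. lborel) (\<lambda>x. \<Prod>i\<in>I. f i (x i))) (Pi\<^sub>E I A) = (\<Prod>i\<in>I. emeasure (N i) (A i))" .
  qed
  also have "PiM I N = (\<Pi>\<^sub>M i\<in>I. density lborel (f i))"
    by (intro PiM_cong) (auto simp: N_def)
  finally show ?thesis ..
qed

lemma distr_rotate_radial:
  assumes [measurable]: "f \<in> borel_measurable borel" and c: "norm c = 1" "Re c \<noteq> 0"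
  shows "distr (density lborel (\<lambda>z::complex. f (norm z))) borel (\<lambda>z. c * z) = density lborel (\<lambda>z. f (norm z))"
proof (rule measure_eqI)
  fix A assume "A \<in> sets (distr (density lborel (\<lambda>z::complex. f (norm z))) borel (\<lambda>z. c * z))"
  then have [measurable]: "A \<in> sets borel" by simp
  have "emeasure (distr (density lborel (\<lambda>z::complex. f (norm z))) borel (\<lambda>z. c * z)) A
     = (\<integral>\<^sup>+z. f (norm z) * indicator ((\<lambda>z. c * z) -` A) z \<partial>lborel)"
    using measurable_sets[of "\<lambda>z. c * z" borel borel A]
    by (subst emeasure_distr) (auto simp: emeasure_density)
  also have "\<dots> = (\<integral>\<^sup>+z. f (norm (c * z)) * indicator A (c * z) \<partial>lborel)"
    using c by (simp add: norm_mult indicator_vimage[symmetric] o_def)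
  also have "\<dots> = (\<integral>\<^sup>+z. f (norm z) * indicator A z \<partial>lborel)"
    using c by (intro nn_integral_lborel_rotate[where f = "\<lambda>z. f (norm z) * indicator A z"]) auto
  also have "\<dots> = emeasure (density lborel (\<lambda>z. f (norm z))) A"
    by (simp add: emeasure_density)
  finally show "emeasure (distr (density lborel (\<lambda>z::complex. f (norm z))) borel (\<lambda>z. c * z)) A = emeasure (density lborel (\<lambda>z. f (norm z))) A" .
qed simp

text \<open>Evaluation on the whole space forces \<open>D = 1\<close>, whatever expression
  \<open>D\<close> is.\<close>

lemma prob_measure_eqI_proportional:
  assumes "prob_space M" "prob_space N" and s: "sets M = sets N"
    and D: "\<And>A. A \<in> sets M \<Longrightarrow> emeasure M A = D * emeasure N A"
  shows "M = N"
proof -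
  interpret M: prob_space M by fact
  interpret N: prob_space N by fact
  have "space M = space N" using sets_eq_imp_space_eq[OF s] .
  then have "1 = D" using D[OF sets.top] M.emeasure_space_1 N.emeasure_space_1 by simp
  then show ?thesis using D s by (intro measure_eqI) auto
qed

section \<open>Squared moduli and the equality of the two laws\<close>

lemma norm_sq_measurable:
  "(\<lambda>z. \<lambda>j\<in>I. (norm (z j :: complex))\<^sup>2) \<in> (\<Pi>\<^sub>M j\<in>I. borel) \<rightarrow>\<^sub>M (\<Pi>\<^sub>M j\<in>I. borel)"
  by measurable

lemma symmetric_function_norm_sq:
  assumes "symmetric_function n g" "\<sigma> permutes {1..n}"
  shows "g (\<lambda>j\<in>{1..n}. (norm (z (\<sigma> j) :: complex))\<^sup>2) = g (\<lambda>j\<in>{1..n}. (norm (z j))\<^sup>2)"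
proof -
  let ?t = "\<lambda>j\<in>{1..n}. (norm (z j))\<^sup>2"
  have "?t \<in> {1..n} \<rightarrow>\<^sub>E UNIV" by simp
  then have "g (\<lambda>j\<in>{1..n}. ?t (\<sigma> j)) = g ?t"
    using assms unfolding symmetric_function_def by blast
  moreover have "(\<lambda>j\<in>{1..n}. ?t (\<sigma> j)) = (\<lambda>j\<in>{1..n}. (norm (z (\<sigma> j)))\<^sup>2)"
    using permutes_in_image[OF assms(2)] by (intro restrict_ext) (simp del: One_nat_def)
  ultimately show ?thesis by simp
qed

theorem lemma3:
  fixes m n :: nat and l :: "nat \<Rightarrow> nat" and C :: real
    and M :: "'a measure" and Z :: "nat \<Rightarrow> 'a \<Rightarrow> complex"
    and N :: "'b measure" and s :: "nat \<Rightarrow> nat \<Rightarrow> 'b \<Rightarrow> real"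
    and K :: "'c measure" and g :: "(nat \<Rightarrow> real) \<Rightarrow> 'c"
  assumes "m \<ge> 1" and "n \<ge> 1"
    and "\<And>r. r \<in> {1..m} \<Longrightarrow> l r \<ge> 1"
    and "prob_space M"
    and "distributed M (\<Pi>\<^sub>M j\<in>{1..n}. lborel) (\<lambda>\<omega>. \<lambda>j\<in>{1..n}. Z j \<omega>) (eigenvalue_density C n m l)"
    and "prob_space N"
    and "prob_space.indep_vars N (\<lambda>_. borel) (\<lambda>(j, r). s j r) ({1..n} \<times> {1..m})"
    and "\<And>j r. j \<in> {1..n} \<Longrightarrow> r \<in> {1..m} \<Longrightarrow>
           distributed N lborel (s j r) (\<lambda>y. ennreal (beta_pdf j (l r) y))"
    and "symmetric_function n g"
    and "g \<in> measurable (\<Pi>\<^sub>M j\<in>{1..n}. borel) K"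
  shows "distr M K (\<lambda>\<omega>. g (\<lambda>j\<in>{1..n}. (norm (Z j \<omega>))\<^sup>2))
       = distr N K (\<lambda>\<omega>. g (\<lambda>j\<in>{1..n}. \<Prod>r\<in>{1..m}. s j r \<omega>))"
proof -
  interpret M: prob_space M by fact
  interpret N: prob_space N by fact
  let ?I = "{1..n}"
  let ?B = "\<Pi>\<^sub>M j\<in>?I. borel :: real measure" and ?L = "\<Pi>\<^sub>M j\<in>?I. lborel :: complex measure"
  have [measurable]: "g \<in> ?B \<rightarrow>\<^sub>M K" by fact
  define w where "w = (\<lambda>z::complex. weight m l (norm z))"
  have [measurable]: "w \<in> borel_measurable borel" unfolding w_def by measurable
  define Y where "Y = (\<lambda>j \<omega>. \<Prod>r\<in>{1..m}. s j r \<omega>)"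

  \<comment> \<open>Grouping the pairs into singleton blocks \<open>{(j, r)}\<close> reindexes row
    \<open>j\<close> by \<open>r\<close>.\<close>
  have iv_row: "N.indep_vars (\<lambda>_. borel) (s j) {1..m}" if j: "j \<in> ?I" for j
  proof -
    have "N.indep_vars (\<lambda>r. \<Pi>\<^sub>M i\<in>{(j, r)}. borel) (\<lambda>r \<omega>. restrict (\<lambda>i. (\<lambda>(j, r). s j r) i \<omega>) {(j, r)}) {1..m}"
      using j by (intro N.indep_vars_restrict[OF assms(7)]) (auto simp: disjoint_family_on_def)
    then have "N.indep_vars (\<lambda>_. borel) (\<lambda>r \<omega>. (\<lambda>x. x (j, r)) (restrict (\<lambda>i. (\<lambda>(j, r). s j r) i \<omega>) {(j, r)})) {1..m}"
      by (rule N.indep_vars_compose2) measurable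
    then show ?thesis by simp
  qed
  \<comment> \<open>Now the blocks are whole rows; these are disjoint, and each \<open>Y j\<close>
    is a function of its own row.\<close>
  have Y_indep: "N.indep_vars (\<lambda>_. borel) Y ?I"
  proof -
    have "N.indep_vars (\<lambda>j. \<Pi>\<^sub>M i\<in>{j} \<times> {1..m}. borel) (\<lambda>j \<omega>. restrict (\<lambda>i. (\<lambda>(j, r). s j r) i \<omega>) ({j} \<times> {1..m})) ?I"
      using assms(1) by (intro N.indep_vars_restrict[OF assms(7)]) (auto simp: disjoint_family_on_def)
    then have "N.indep_vars (\<lambda>_. borel) (\<lambda>j \<omega>. (\<lambda>x. \<Prod>r\<in>{1..m}. x (j, r)) (restrict (\<lambda>i. (\<lambda>(j, r). s j r) i \<omega>) ({j} \<times> {1..m}))) ?I"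
      by (rule N.indep_vars_compose2) measurable
    moreover have "(\<lambda>j \<omega>. (\<lambda>x. \<Prod>r\<in>{1..m}. x (j, r)) (restrict (\<lambda>i. (\<lambda>(j, r). s j r) i \<omega>) ({j} \<times> {1..m}))) = Y"
      unfolding Y_def by (intro ext prod.cong refl) auto
    ultimately show ?thesis by simp
  qed
  have Y_measurable: "Y j \<in> borel_measurable N" if "j \<in> ?I" for j
    using Y_indep that unfolding N.indep_vars_def by auto
  have Y_vec[measurable]: "(\<lambda>\<omega>. \<lambda>j\<in>?I. Y j \<omega>) \<in> N \<rightarrow>\<^sub>M ?B"
    using Y_measurable by (rule measurable_restrict)
  have Y_distr: "distr N ?B (\<lambda>\<omega>. \<lambda>j\<in>?I. Y j \<omega>) = (\<Pi>\<^sub>M j\<in>?I. distr N borel (Y j))"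
    using Y_indep assms(2) Y_measurable by (subst N.indep_vars_iff_distr_eq_PiM'[symmetric]) auto

  have "\<forall>j\<in>?I. \<exists>c>0. \<forall>h\<in>borel_measurable borel.
    (\<integral>\<^sup>+z. h ((norm (z::complex))\<^sup>2) * ennreal (norm z ^ (2 * (j - 1))) * w z \<partial>lborel)
      = ennreal c * (\<integral>\<^sup>+\<omega>. h (Y j \<omega>) \<partial>N)"
    unfolding w_def Y_def
    by (intro ballI nn_integral_norm_weight[OF assms(6)] iv_row) (use assms in auto)
  from bchoice[OF this] obtain c where c': "\<forall>j\<in>?I. c j > 0 \<and> (\<forall>h\<in>borel_measurable borel.
    (\<integral>\<^sup>+z. h ((norm (z::complex))\<^sup>2) * ennreal (norm z ^ (2 * (j - 1))) * w z \<partial>lborel)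
      = ennreal (c j) * (\<integral>\<^sup>+\<omega>. h (Y j \<omega>) \<partial>N))" by blast
  have c: "c j > 0" if "j \<in> ?I" for j using c' that by blast
  have ch: "(\<integral>\<^sup>+z. h ((norm (z::complex))\<^sup>2) * ennreal (norm z ^ (2 * (j - 1))) * w z \<partial>lborel)
      = ennreal (c j) * (\<integral>\<^sup>+\<omega>. h (Y j \<omega>) \<partial>N)" if "j \<in> ?I" "h \<in> borel_measurable borel" for j h
    using c' that by blast

  \<comment> \<open>The radial density of the independent model at index \<open>j\<close>,
    normalised by the unspecified constant \<open>c j\<close> of the moment identity.\<close>
  define \<phi> where "\<phi> = (\<lambda>j r. ennreal (r ^ (2 * (j - 1))) * weight m l r * ennreal (1 / c j))"
  have \<phi>_m[measurable]: "\<phi> j \<in> borel_measurable borel" for j unfolding \<phi>_def by measurable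
  define \<nu> where "\<nu> = (\<lambda>j. density lborel (\<lambda>z::complex. \<phi> j (norm z)))"
  have \<nu>_sets[measurable_cong]: "sets (\<nu> j) = sets borel" for j by (simp add: \<nu>_def)
  have \<nu>_distr: "distr (\<nu> j) borel (\<lambda>z. (norm z)\<^sup>2) = distr N borel (Y j)" if j: "j \<in> ?I" for j
  proof (rule measure_eqI)
    fix A assume "A \<in> sets (distr (\<nu> j) borel (\<lambda>z. (norm z)\<^sup>2))"
    then have A[measurable]: "A \<in> sets borel" by simp
    note [measurable] = Y_measurable[OF j]
    have "emeasure (distr (\<nu> j) borel (\<lambda>z. (norm z)\<^sup>2)) A = (\<integral>\<^sup>+z. indicator A ((norm z)\<^sup>2) \<partial>\<nu> j)"
      by (rule emeasure_distr_eq_nn_integral) measurable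
    also have "\<dots> = (\<integral>\<^sup>+z. ennreal (1 / c j) * (indicator A ((norm (z::complex))\<^sup>2) * ennreal (norm z ^ (2 * (j - 1))) * w z) \<partial>lborel)"
      unfolding \<nu>_def by (subst nn_integral_density) (auto simp: \<phi>_def w_def mult_ac)
    also have "\<dots> = ennreal (1 / c j) * (\<integral>\<^sup>+z. indicator A ((norm (z::complex))\<^sup>2) * ennreal (norm z ^ (2 * (j - 1))) * w z \<partial>lborel)"
      by (rule nn_integral_cmult) measurable
    also have "\<dots> = ennreal (1 / c j) * (ennreal (c j) * (\<integral>\<^sup>+\<omega>. indicator A (Y j \<omega>) \<partial>N))"
      by (subst ch[OF j]) auto
    also have "\<dots> = (\<integral>\<^sup>+\<omega>. indicator A (Y j \<omega>) \<partial>N)"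
      using c[OF j] by (simp add: mult.assoc[symmetric] ennreal_mult[symmetric])
    also have "\<dots> = emeasure (distr N borel (Y j)) A"
      by (rule emeasure_distr_eq_nn_integral[symmetric]) measurable
    finally show "emeasure (distr (\<nu> j) borel (\<lambda>z. (norm z)\<^sup>2)) A = emeasure (distr N borel (Y j)) A" .
  qed simp
  \<comment> \<open>Total mass 1 is inherited from the law of \<open>Y j\<close>; no integral of the
    weight is evaluated.\<close>
  have \<nu>_prob: "prob_space (\<nu> j)" if j: "j \<in> ?I" for j
  proof (rule prob_space_distrD)
    show "(\<lambda>z. (norm z)\<^sup>2) \<in> borel_measurable (\<nu> j)" by measurable
    show "prob_space (distr (\<nu> j) borel (\<lambda>z. (norm z)\<^sup>2))"
      unfolding \<nu>_distr[OF j] by (rule N.prob_space_distr[OF Y_measurable[OF j]])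
  qed
  let ?sq = "\<lambda>z. \<lambda>j\<in>?I. (norm (z j :: complex))\<^sup>2"
  have one: "1 \<in> ?I" using assms(2) by simp
  have PiM_\<nu>: "(\<Pi>\<^sub>M j\<in>?I. \<nu> j) = density ?L (\<lambda>z. \<Prod>j\<in>?I. \<phi> j (norm (z j)))"
    unfolding \<nu>_def using \<nu>_prob[unfolded \<nu>_def] by (intro PiM_density_lborel) auto
  \<comment> \<open>The reference measure of the expansion: for \<open>j = 1\<close> the power of
    the modulus is trivial, so each factor has the bare weight divided by \<open>c 1\<close> as
    density.\<close>
  have PiM_\<nu>1: "(\<Pi>\<^sub>M j\<in>?I. \<nu> 1) = density ?L (\<lambda>z. \<Prod>j\<in>?I. \<phi> 1 (norm (z j)))"
    unfolding \<nu>_def using \<nu>_prob[OF one, unfolded \<nu>_def] by (intro PiM_density_lborel) auto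
  have PiM_\<nu>_distr: "distr (\<Pi>\<^sub>M j\<in>?I. \<nu> j) ?B ?sq = distr N ?B (\<lambda>\<omega>. \<lambda>j\<in>?I. Y j \<omega>)"
  proof -
    let ?M' = "\<lambda>j. distr N borel (Y j)"
    \<comment> \<open>Putting the laws of \<open>Y j\<close> on the target leaves
      \<open>distr\<close> unchanged, as only the measurable sets count; it makes the factors of the
      target probability measures.\<close>
    have "distr (\<Pi>\<^sub>M j\<in>?I. \<nu> j) ?B ?sq = distr (\<Pi>\<^sub>M j\<in>?I. \<nu> j) (\<Pi>\<^sub>M j\<in>?I. ?M' j) (compose ?I (\<lambda>z. (norm z)\<^sup>2))"
      by (intro distr_cong refl sets_PiM_cong) (auto simp: compose_def)
    also have "\<dots> = (\<Pi>\<^sub>M j\<in>?I. distr (\<nu> j) (?M' j) (\<lambda>z. (norm z)\<^sup>2))"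
      using \<nu>_prob N.prob_space_distr[OF Y_measurable]
      by (intro distr_PiM_finite_prob_space') auto
    also have "\<dots> = (\<Pi>\<^sub>M j\<in>?I. ?M' j)"
    proof (rule PiM_cong[OF refl])
      fix j assume "j \<in> ?I"
      have "distr (\<nu> j) (?M' j) (\<lambda>z. (norm z)\<^sup>2) = distr (\<nu> j) borel (\<lambda>z. (norm z)\<^sup>2)"
        by (intro distr_cong) auto
      then show "distr (\<nu> j) (?M' j) (\<lambda>z. (norm z)\<^sup>2) = ?M' j" using \<nu>_distr[OF \<open>j \<in> ?I\<close>] by simp
    qed
    finally show ?thesis unfolding Y_distr .
  qed

  define V where "V = (\<lambda>z :: nat \<Rightarrow> complex. \<Prod>j\<in>?I. \<Prod>k\<in>{j<..n}. (norm (z j - z k))\<^sup>2)"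
  define G where "G = (\<lambda>z :: nat \<Rightarrow> complex. \<Prod>j\<in>?I. norm (z j) ^ (2 * (j - 1)))"
  \<comment> \<open>\<open>C\<close> comes from the density, \<open>c 1 ^ n\<close> undoes the
    normalisation of the reference measure, \<open>fact n\<close> counts the surviving permutation
    terms, and the ratios \<open>c j / c 1\<close> pass from \<open>\<phi> 1\<close> to
    \<open>\<phi> j\<close>.\<close>
  define D where "D = ennreal C * ennreal (c 1 ^ n) * (ennreal (fact n) * ennreal (\<Prod>j\<in>?I. c j / c 1))"
  have \<phi>_1: "(\<Prod>j\<in>?I. \<phi> 1 (norm (z j))) = (\<Prod>j\<in>?I. w (z j)) * ennreal ((1 / c 1) ^ n)" for z :: "nat \<Rightarrow> complex"
    using c[OF one] by (simp add: \<phi>_def w_def prod.distrib ennreal_power)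
  \<comment> \<open>\<open>G\<close> is the diagonal monomial left by the expansion; its factors
    supply exactly the powers by which \<open>\<phi> j\<close> differs from
    \<open>\<phi> 1\<close>.\<close>
  have \<phi>_G: "(\<Prod>j\<in>?I. \<phi> 1 (norm (z j))) * ennreal (G z) = ennreal (\<Prod>j\<in>?I. c j / c 1) * (\<Prod>j\<in>?I. \<phi> j (norm (z j)))" for z
  proof -
    have "(\<Prod>j\<in>?I. \<phi> 1 (norm (z j))) * ennreal (G z) = (\<Prod>j\<in>?I. \<phi> 1 (norm (z j)) * ennreal (norm (z j) ^ (2 * (j - 1))))"
      unfolding G_def by (simp add: prod.distrib prod_ennreal)
    also have "\<dots> = (\<Prod>j\<in>?I. ennreal (c j / c 1) * \<phi> j (norm (z j)))"
    proof (rule prod.cong[OF refl])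
      fix j assume j: "j \<in> ?I"
      have H: "ennreal (1 / c 1) = ennreal (c j / c 1) * ennreal (1 / c j)"
        using c[OF j] c[OF one] by (simp add: ennreal_mult[symmetric])
      have "\<phi> 1 r = weight m l r * ennreal (1 / c 1)" for r by (simp add: \<phi>_def)
      then show "\<phi> 1 (norm (z j)) * ennreal (norm (z j) ^ (2 * (j - 1))) = ennreal (c j / c 1) * \<phi> j (norm (z j))"
        unfolding H by (simp only: \<phi>_def mult_ac)
    qed
    also have "\<dots> = ennreal (\<Prod>j\<in>?I. c j / c 1) * (\<Prod>j\<in>?I. \<phi> j (norm (z j)))"
    proof -
      have "(\<Prod>j\<in>?I. ennreal (c j / c 1)) = ennreal (\<Prod>j\<in>?I. c j / c 1)"
        using c one by (intro prod_ennreal) (simp add: less_imp_le del: One_nat_def)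
      then show ?thesis by (simp only: prod.distrib)
    qed
    finally show ?thesis .
  qed

  show ?thesis
  proof (rule prob_measure_eqI_proportional[where D = D])
    have Zm: "(\<lambda>\<omega>. \<lambda>j\<in>?I. Z j \<omega>) \<in> M \<rightarrow>\<^sub>M ?L" using assms(5) by (rule distributed_measurable)
    have Lb: "sets ?L = sets (\<Pi>\<^sub>M j\<in>?I. borel :: complex measure)" by (intro sets_PiM_cong) auto
    have sq[measurable]: "?sq \<in> ?L \<rightarrow>\<^sub>M ?B"
      using norm_sq_measurable[of ?I] by (simp only: measurable_cong_sets[OF Lb refl])
    have sqZ: "?sq (\<lambda>j\<in>?I. Z j \<omega>) = (\<lambda>j\<in>?I. (norm (Z j \<omega>))\<^sup>2)" for \<omega>
      by (intro restrict_ext) simp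
    have X1[measurable]: "(\<lambda>\<omega>. g (\<lambda>j\<in>?I. (norm (Z j \<omega>))\<^sup>2)) \<in> M \<rightarrow>\<^sub>M K"
      using measurable_compose[OF measurable_compose[OF Zm sq] assms(10)] unfolding sqZ .
    have X2[measurable]: "(\<lambda>\<omega>. g (\<lambda>j\<in>?I. \<Prod>r\<in>{1..m}. s j r \<omega>)) \<in> N \<rightarrow>\<^sub>M K"
      using measurable_compose[OF Y_vec assms(10)] unfolding Y_def .
    show "prob_space (distr M K (\<lambda>\<omega>. g (\<lambda>j\<in>?I. (norm (Z j \<omega>))\<^sup>2)))" by (rule M.prob_space_distr[OF X1])
    show "prob_space (distr N K (\<lambda>\<omega>. g (\<lambda>j\<in>?I. \<Prod>r\<in>{1..m}. s j r \<omega>)))" by (rule N.prob_space_distr[OF X2])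
    show "sets (distr M K (\<lambda>\<omega>. g (\<lambda>j\<in>?I. (norm (Z j \<omega>))\<^sup>2))) = sets (distr N K (\<lambda>\<omega>. g (\<lambda>j\<in>?I. \<Prod>r\<in>{1..m}. s j r \<omega>)))"
      by simp
    fix A assume "A \<in> sets (distr M K (\<lambda>\<omega>. g (\<lambda>j\<in>?I. (norm (Z j \<omega>))\<^sup>2)))"
    then have A[measurable]: "A \<in> sets K" by simp
    define E where "E = (\<lambda>z :: nat \<Rightarrow> complex. indicator A (g (?sq z)) :: real)"
    \<comment> \<open>The cut-off makes the monomials bounded and costs nothing, since the joint
      density and the weights vanish beyond radius 1.\<close>
    define F where "F = (\<lambda>z. E z * (if \<forall>j\<in>?I. norm (z j) < 1 then 1 else 0))"
    have E_m[measurable]: "E \<in> borel_measurable (\<Pi>\<^sub>M j\<in>?I. borel)"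
      unfolding E_def using norm_sq_measurable[of ?I] by measurable
    have F_m[measurable]: "F \<in> borel_measurable (\<Pi>\<^sub>M j\<in>?I. borel)"
      unfolding F_def by measurable
    interpret R: radial_product "\<nu> 1" n F 1
    proof (rule radial_product.intro)
      show "prob_space (\<nu> 1)" by (rule \<nu>_prob[OF one])
      show "sets (\<nu> 1) = sets borel" by (rule \<nu>_sets)
      show "distr (\<nu> 1) borel (\<lambda>z. c * z) = \<nu> 1" if "norm c = 1" "Re c \<noteq> 0" for c
        unfolding \<nu>_def using that by (intro distr_rotate_radial) auto
      show "F \<in> borel_measurable (\<Pi>\<^sub>M j\<in>?I. borel)" by (rule F_m)
      show "\<bar>F z\<bar> \<le> 1" for z by (simp add: F_def E_def indicator_def)
      show "F z = 0" if "j \<in> ?I" "norm (z j) \<ge> 1" for j z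
        using that by (force simp: F_def)
      show "F (z(j := c * z j)) = F z" if "norm c = 1" for c j z
      proof -
        have "norm ((z(j := c * z j)) i) = norm (z i)" for i using that by (simp add: norm_mult)
        then show ?thesis unfolding F_def E_def by presburger
      qed
      show "F (\<lambda>j\<in>?I. z (\<sigma> j)) = F z" if s: "\<sigma> permutes ?I" and "z \<in> extensional ?I" for \<sigma> z
      proof -
        have "(\<forall>j\<in>?I. norm (z (\<sigma> j)) < 1) \<longleftrightarrow> (\<forall>j\<in>\<sigma> ` ?I. norm (z j) < 1)" by blast
        moreover have "?sq (\<lambda>j\<in>?I. z (\<sigma> j)) = (\<lambda>j\<in>?I. (norm (z (\<sigma> j)))\<^sup>2)"
          by (intro restrict_ext) simp
        ultimately show ?thesis
          unfolding F_def E_def permutes_image[OF s]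
          using symmetric_function_norm_sq[OF assms(9) s, of z] by simp
      qed
    qed
    have nn: "0 \<le> F z" "0 \<le> E z" "0 \<le> V z" "0 \<le> G z" for z
      by (auto simp: F_def E_def V_def G_def intro!: prod_nonneg)
    have [measurable]: "V \<in> borel_measurable (\<Pi>\<^sub>M j\<in>?I. borel)" "G \<in> borel_measurable (\<Pi>\<^sub>M j\<in>?I. borel)"
      unfolding V_def G_def
      by (intro borel_measurable_prod borel_measurable_power borel_measurable_norm borel_measurable_diff
          measurable_component_singleton; auto)+
    have Lm: "f \<in> borel_measurable (\<Pi>\<^sub>M j\<in>?I. borel) \<Longrightarrow> f \<in> borel_measurable ?L" for f :: "(nat \<Rightarrow> complex) \<Rightarrow> ennreal"
      by (simp only: measurable_cong_sets[OF Lb refl])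
    have "emeasure (distr M K (\<lambda>\<omega>. g (\<lambda>j\<in>?I. (norm (Z j \<omega>))\<^sup>2))) A = (\<integral>\<^sup>+\<omega>. ennreal (E (\<lambda>j\<in>?I. Z j \<omega>)) \<partial>M)"
      unfolding E_def sqZ ennreal_indicator by (rule emeasure_distr_eq_nn_integral[OF X1 A])
    also have "\<dots> = (\<integral>\<^sup>+z. eigenvalue_density C n m l z * ennreal (E z) \<partial>?L)"
      by (rule distributed_nn_integral[OF assms(5), symmetric]) (rule Lm, measurable)
    \<comment> \<open>The restriction of the density to the polydisc is the cut-off in
      \<open>F\<close>, and \<open>c 1 ^ n\<close> compensates for the \<open>n\<close> normalised
      copies of \<open>\<phi> 1\<close>.\<close>
    also have "\<dots> = (\<integral>\<^sup>+z. ennreal C * ennreal (c 1 ^ n) * ((\<Prod>j\<in>?I. \<phi> 1 (norm (z j))) * ennreal (F z * V z)) \<partial>?L)"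
    proof (rule nn_integral_cong)
      fix z :: "nat \<Rightarrow> complex"
      have M: "(MAX j\<in>?I. norm (z j)) < 1 \<longleftrightarrow> (\<forall>j\<in>?I. norm (z j) < 1)"
        using one by (subst Max_less_iff) auto
      show "eigenvalue_density C n m l z * ennreal (E z) = ennreal C * ennreal (c 1 ^ n) * ((\<Prod>j\<in>?I. \<phi> 1 (norm (z j))) * ennreal (F z * V z))"
      proof (cases "\<forall>j\<in>?I. norm (z j) < 1")
        case True
        have H: "ennreal (c 1 ^ n) * ennreal ((1 / c 1) ^ n) = 1"
          using c[OF one] by (simp add: ennreal_mult[symmetric] power_mult_distrib[symmetric])
        have "ennreal C * ennreal (c 1 ^ n) * ((\<Prod>j\<in>?I. \<phi> 1 (norm (z j))) * ennreal (F z * V z))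
          = ennreal C * (\<Prod>j\<in>?I. w (z j)) * ennreal (F z * V z) * (ennreal (c 1 ^ n) * ennreal ((1 / c 1) ^ n))"
          unfolding \<phi>_1 by (simp only: mult_ac)
        also have "\<dots> = ennreal C * (\<Prod>j\<in>?I. w (z j)) * ennreal (E z * V z)"
          unfolding H F_def if_P[OF True] by (simp only: mult_1_right)
        also have "\<dots> = ennreal C * ennreal (V z) * (\<Prod>j\<in>?I. w (z j)) * ennreal (E z)"
          using nn by (simp only: ennreal_mult mult_ac)
        also have "ennreal C * ennreal (V z) * (\<Prod>j\<in>?I. w (z j)) = eigenvalue_density C n m l z"
          unfolding eigenvalue_density_def M V_def w_def if_P[OF True] ..
        finally show ?thesis ..
      next
        case False
        show ?thesis unfolding eigenvalue_density_def M F_def if_not_P[OF False] by simp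
      qed
    qed
    also have "\<dots> = ennreal C * ennreal (c 1 ^ n) * (\<integral>\<^sup>+z. (\<Prod>j\<in>?I. \<phi> 1 (norm (z j))) * ennreal (F z * V z) \<partial>?L)"
      by (rule nn_integral_cmult) (rule Lm, measurable)
    also have "(\<integral>\<^sup>+z. (\<Prod>j\<in>?I. \<phi> 1 (norm (z j))) * ennreal (F z * V z) \<partial>?L) = (\<integral>\<^sup>+z. ennreal (F z * V z) \<partial>(\<Pi>\<^sub>M j\<in>?I. \<nu> 1))"
      unfolding PiM_\<nu>1 by (rule nn_integral_density[symmetric]) (rule Lm, measurable)+
    \<comment> \<open>The permutation identity concerns Bochner integrals; nonnegativity and
      integrability allow the passage there and back.\<close>
    also have "\<dots> = ennreal (\<integral>z. F z * V z \<partial>(\<Pi>\<^sub>M j\<in>?I. \<nu> 1))"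
      using R.integral_vandermonde(1) nn unfolding V_def by (intro nn_integral_eq_integral) auto
    also have "\<dots> = ennreal (fact n * (\<integral>z. F z * G z \<partial>(\<Pi>\<^sub>M j\<in>?I. \<nu> 1)))"
      using R.integral_vandermonde(3) unfolding V_def G_def by simp
    also have "\<dots> = ennreal (fact n) * (\<integral>\<^sup>+z. ennreal (F z * G z) \<partial>(\<Pi>\<^sub>M j\<in>?I. \<nu> 1))"
      using R.integral_vandermonde(2) nn unfolding G_def
      by (subst nn_integral_eq_integral) (auto simp: ennreal_mult')
    also have "(\<integral>\<^sup>+z. ennreal (F z * G z) \<partial>(\<Pi>\<^sub>M j\<in>?I. \<nu> 1)) = (\<integral>\<^sup>+z. (\<Prod>j\<in>?I. \<phi> 1 (norm (z j))) * ennreal (F z * G z) \<partial>?L)"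
      unfolding PiM_\<nu>1 by (rule nn_integral_density) (rule Lm, measurable)+
    \<comment> \<open>The cut-off is removed again: if some modulus is at least 1, the corresponding
      factor \<open>\<phi> j\<close> is 0.\<close>
    also have "\<dots> = (\<integral>\<^sup>+z. ennreal (\<Prod>j\<in>?I. c j / c 1) * ((\<Prod>j\<in>?I. \<phi> j (norm (z j))) * ennreal (E z)) \<partial>?L)"
    proof (rule nn_integral_cong)
      fix z :: "nat \<Rightarrow> complex"
      have "(\<Prod>j\<in>?I. \<phi> j (norm (z j))) * ennreal (F z) = (\<Prod>j\<in>?I. \<phi> j (norm (z j))) * ennreal (E z)"
      proof (cases "\<forall>j\<in>?I. norm (z j) < 1")
        case True
        then show ?thesis unfolding F_def if_P[OF True] by simp
      next
        case False
        then obtain j where "j \<in> ?I" "\<phi> j (norm (z j)) = 0"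
          by (auto simp: \<phi>_def weight_eq_0 not_less)
        then have "(\<Prod>j\<in>?I. \<phi> j (norm (z j))) = 0" by (intro prod_zero) auto
        then show ?thesis by (simp only: mult_zero_left)
      qed
      moreover have "(\<Prod>j\<in>?I. \<phi> 1 (norm (z j))) * ennreal (F z * G z) = (\<Prod>j\<in>?I. \<phi> 1 (norm (z j))) * ennreal (G z) * ennreal (F z)"
        using nn by (simp add: ennreal_mult mult_ac)
      ultimately show "(\<Prod>j\<in>?I. \<phi> 1 (norm (z j))) * ennreal (F z * G z) = ennreal (\<Prod>j\<in>?I. c j / c 1) * ((\<Prod>j\<in>?I. \<phi> j (norm (z j))) * ennreal (E z))"
        unfolding \<phi>_G by (simp add: mult.assoc)
    qed
    also have "\<dots> = ennreal (\<Prod>j\<in>?I. c j / c 1) * (\<integral>\<^sup>+z. (\<Prod>j\<in>?I. \<phi> j (norm (z j))) * ennreal (E z) \<partial>?L)"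
      by (rule nn_integral_cmult) (rule Lm, measurable)
    also have "(\<integral>\<^sup>+z. (\<Prod>j\<in>?I. \<phi> j (norm (z j))) * ennreal (E z) \<partial>?L) = (\<integral>\<^sup>+z. ennreal (E z) \<partial>(\<Pi>\<^sub>M j\<in>?I. \<nu> j))"
      unfolding PiM_\<nu> by (rule nn_integral_density[symmetric]) (rule Lm, measurable)+
    \<comment> \<open>\<open>E\<close> factors through the squared moduli, whose joint law under the
      product of the \<open>\<nu> j\<close> is that of the \<open>Y j\<close>.\<close>
    also have "\<dots> = (\<integral>\<^sup>+t. indicator A (g t) \<partial>distr (\<Pi>\<^sub>M j\<in>?I. \<nu> j) ?B ?sq)"
      unfolding E_def ennreal_indicator by (rule nn_integral_distr[symmetric]) measurable
    also have "\<dots> = (\<integral>\<^sup>+\<omega>. indicator A (g (\<lambda>j\<in>?I. Y j \<omega>)) \<partial>N)"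
      unfolding PiM_\<nu>_distr by (rule nn_integral_distr) measurable
    also have "\<dots> = emeasure (distr N K (\<lambda>\<omega>. g (\<lambda>j\<in>?I. \<Prod>r\<in>{1..m}. s j r \<omega>))) A"
      unfolding Y_def by (rule emeasure_distr_eq_nn_integral[OF X2 A, symmetric])
    finally show "emeasure (distr M K (\<lambda>\<omega>. g (\<lambda>j\<in>?I. (norm (Z j \<omega>))\<^sup>2))) A
      = D * emeasure (distr N K (\<lambda>\<omega>. g (\<lambda>j\<in>?I. \<Prod>r\<in>{1..m}. s j r \<omega>))) A"
      unfolding D_def by (simp only: mult.assoc)
  qed
qed

end
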